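(* Let $m\in H^\infty$ be inner, $H=H^2\ominus mH^2$ with $\dim H\ge2$, and $T=P_HS|_H$ (so $m=m_T$ is the minimal/characteristic function of $T$). Suppose: (A) $m(\lambda)\not\equiv m(-\lambda)$ on $\mathbb D$; (B) for every $\lambda_0\in\mathbb D$ with $m(\lambda_0)=0$, the function $m_{\lambda_0}(\lambda)=m(\lambda)\Big/\dfrac{\lambda-\lambda_0}{1-\bar\lambda_0\lambda}$ satisfies $m_{\lambda_0}(\lambda)\not\equiv m_{\lambda_0}(-\lambda)$; (C) there exists a nonconstant inner divisor $p\in H^\infty$ of $m$ with $p(\lambda)=p(-\lambda)$ for all $\lambda\in\mathbb D$. Then (D) $T^2$ is irreducible, and (E) $\mathrm{Lat}\{T^2\}\ne\mathrm{Lat}\{T^2\}'$.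
   Context: $S$ is the unilateral shift $(Sh)(z)=zh(z)$ on the Hardy space $H^2$ of the unit disc $\mathbb D$; $P_H$ is the orthogonal projection onto $H$. Irreducible means having no closed subspace other than $\{0\}$ and the whole space invariant under both the operator and its adjoint. $\mathrm{Lat}\{X\}$ is the lattice of closed invariant subspaces of $X$; $\mathrm{Lat}\{X\}'$ is the lattice of hyperinvariant subspaces (closed subspaces invariant under every operator commuting with $X$). *)

theory Defs
  imports "HOL-Complex_Analysis.Complex_Analysis"
begin

abbreviation disc :: "complex set" where "disc \<equiv> ball 0 1"

definition tcoeff :: "nat \<Rightarrow> (complex \<Rightarrow> complex) \<Rightarrow> complex" where
  "tcoeff n f = (deriv ^^ n) f 0 / fact n"

text \<open>Hardy space H^2 of the unit disc.  Elements are holomorphic functions on the disc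
  with square-summable Taylor coefficients; to make the representation unique, they are
  normalised to vanish outside the disc.\<close>
definition H2 :: "(complex \<Rightarrow> complex) set" where
  "H2 = {f. f holomorphic_on disc \<and> (\<forall>z. z \<notin> disc \<longrightarrow> f z = 0)
            \<and> summable (\<lambda>n. (cmod (tcoeff n f))\<^sup>2)}"

definition h2_inner :: "(complex \<Rightarrow> complex) \<Rightarrow> (complex \<Rightarrow> complex) \<Rightarrow> complex" where
  "h2_inner f g = (\<Sum>n. tcoeff n f * cnj (tcoeff n g))"

definition h2_norm :: "(complex \<Rightarrow> complex) \<Rightarrow> real" where
  "h2_norm f = sqrt (Re (h2_inner f f))"

definition closed_subspace :: "(complex \<Rightarrow> complex) set \<Rightarrow> bool" where
  "closed_subspace M \<longleftrightarrow> M \<subseteq> H2 \<and> (\<lambda>z. 0) \<in> M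
     \<and> (\<forall>f\<in>M. \<forall>g\<in>M. (\<lambda>z. f z + g z) \<in> M)
     \<and> (\<forall>c. \<forall>f\<in>M. (\<lambda>z. c * f z) \<in> M)
     \<and> (\<forall>x f. (\<forall>n. x n \<in> M) \<and> f \<in> H2 \<and> (\<lambda>n. h2_norm (\<lambda>z. x n z - f z)) \<longlonglongrightarrow> 0
              \<longrightarrow> f \<in> M)"

definition proj :: "(complex \<Rightarrow> complex) set \<Rightarrow> (complex \<Rightarrow> complex) \<Rightarrow> (complex \<Rightarrow> complex)" where
  "proj K f = (THE h. h \<in> K \<and> (\<forall>k\<in>K. h2_inner (\<lambda>z. f z - h z) k = 0))"

definition Hinf :: "(complex \<Rightarrow> complex) set" where
  "Hinf = {m. m holomorphic_on disc \<and> bounded (m ` disc)}"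

definition inner_fun :: "(complex \<Rightarrow> complex) \<Rightarrow> bool" where
  "inner_fun m \<longleftrightarrow> m \<in> Hinf \<and>
     (AE \<theta> in lborel. \<theta> \<in> {0..2*pi} \<longrightarrow>
        (\<exists>L. cmod L = 1 \<and> ((\<lambda>r. m (complex_of_real r * cis \<theta>)) \<longlongrightarrow> L) (at_left 1)))"

definition mH2 :: "(complex \<Rightarrow> complex) \<Rightarrow> (complex \<Rightarrow> complex) set" where
  "mH2 m = {\<lambda>z. m z * g z | g. g \<in> H2}"

definition model_space :: "(complex \<Rightarrow> complex) \<Rightarrow> (complex \<Rightarrow> complex) set" where
  "model_space m = {f \<in> H2. \<forall>g \<in> mH2 m. h2_inner f g = 0}"

definition shift :: "(complex \<Rightarrow> complex) \<Rightarrow> (complex \<Rightarrow> complex)" where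
  "shift h = (\<lambda>z. z * h z)"

definition Tm :: "(complex \<Rightarrow> complex) \<Rightarrow> (complex \<Rightarrow> complex) \<Rightarrow> (complex \<Rightarrow> complex)" where
  "Tm m f = proj (model_space m) (shift f)"

definition bounded_op :: "(complex \<Rightarrow> complex) set \<Rightarrow> ((complex \<Rightarrow> complex) \<Rightarrow> (complex \<Rightarrow> complex)) \<Rightarrow> bool" where
  "bounded_op H A \<longleftrightarrow> (\<forall>f\<in>H. A f \<in> H)
     \<and> (\<forall>f\<in>H. \<forall>g\<in>H. A (\<lambda>z. f z + g z) = (\<lambda>z. A f z + A g z))
     \<and> (\<forall>c. \<forall>f\<in>H. A (\<lambda>z. c * f z) = (\<lambda>z. c * A f z))
     \<and> (\<exists>C. \<forall>f\<in>H. h2_norm (A f) \<le> C * h2_norm f)"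

definition adj :: "(complex \<Rightarrow> complex) set \<Rightarrow> ((complex \<Rightarrow> complex) \<Rightarrow> (complex \<Rightarrow> complex))
                     \<Rightarrow> (complex \<Rightarrow> complex) \<Rightarrow> (complex \<Rightarrow> complex)" where
  "adj H X g = (THE h. h \<in> H \<and> (\<forall>f\<in>H. h2_inner (X f) g = h2_inner f h))"

definition invariant :: "((complex \<Rightarrow> complex) \<Rightarrow> (complex \<Rightarrow> complex)) \<Rightarrow> (complex \<Rightarrow> complex) set \<Rightarrow> bool" where
  "invariant X M \<longleftrightarrow> (\<forall>f\<in>M. X f \<in> M)"

definition irreducible_op :: "(complex \<Rightarrow> complex) set \<Rightarrow> ((complex \<Rightarrow> complex) \<Rightarrow> (complex \<Rightarrow> complex)) \<Rightarrow> bool" where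
  "irreducible_op H X \<longleftrightarrow> (\<forall>M. closed_subspace M \<and> M \<subseteq> H \<and> invariant X M \<and> invariant (adj H X) M
        \<longrightarrow> M = {\<lambda>z. 0} \<or> M = H)"

definition Lat :: "(complex \<Rightarrow> complex) set \<Rightarrow> ((complex \<Rightarrow> complex) \<Rightarrow> (complex \<Rightarrow> complex)) \<Rightarrow> (complex \<Rightarrow> complex) set set" where
  "Lat H X = {M. closed_subspace M \<and> M \<subseteq> H \<and> invariant X M}"

definition HypLat :: "(complex \<Rightarrow> complex) set \<Rightarrow> ((complex \<Rightarrow> complex) \<Rightarrow> (complex \<Rightarrow> complex)) \<Rightarrow> (complex \<Rightarrow> complex) set set" where
  "HypLat H X = {M. closed_subspace M \<and> M \<subseteq> H \<and>
      (\<forall>A. bounded_op H A \<and> (\<forall>f\<in>H. A (X f) = X (A f)) \<longrightarrow> invariant A M)}"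

end

theory Submission
  imports Defs
begin

text \<open>Write \<open>v\<^sub>n\<close> for the projection of \<open>z\<^sup>n\<close> to the model space \<open>H\<close>, so that \<open>T v\<^sub>n = v\<^sub>n\<^sub>+\<^sub>1\<close>; the adjoint of \<open>T\<close>
  is the backward shift \<open>B\<close>, and \<open>f - T\<^sup>2 B\<^sup>2 f = f\<^sub>0 v\<^sub>0 + f\<^sub>1 v\<^sub>1\<close>. Let \<open>M\<close> reduce \<open>T\<^sup>2\<close> and let \<open>L\<close> be the
  space of pairs \<open>(f\<^sub>0, f\<^sub>1)\<close> with \<open>f \<in> M\<close>. If \<open>L\<close> is trivial, then \<open>M = 0\<close>; if it is all of \<open>\<complex>\<^sup>2\<close>, then
  all \<open>v\<^sub>n\<close> lie in \<open>M\<close> and \<open>M = H\<close>. If \<open>L\<close> is spanned by \<open>(a, b)\<close>, then \<open>b f\<^sub>2\<^sub>n = a f\<^sub>2\<^sub>n\<^sub>+\<^sub>1\<close> throughout \<open>M\<close>,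
  and applying this to \<open>a v\<^sub>2\<^sub>k + b v\<^sub>2\<^sub>k\<^sub>+\<^sub>1\<close> forces either all odd coefficients of \<open>m\<close> to vanish,
  contradicting (A), or \<open>(z - y - w z\<^sup>2) m(z)\<close> to be even for some constants \<open>y, w\<close>. Since \<open>m\<close> is inner,
  \<open>w\<close> is minus the conjugate of \<open>y\<close>, the quadratic factor has a root \<open>\<lambda>\<close> in the disc, and
  \<open>- \<lambda>\<close> is a zero of \<open>m\<close> violating (B).

  For (E), let \<open>N\<close> be the odd functions in the model space of the even divisor \<open>p\<close>. Its complement
  in \<open>H\<close> is invariant under \<open>T\<^sup>2\<close> and contains the projection \<open>h\<close> of 1 to that space, but it does not contain
  \<open>T h\<close>, because \<open>z h \<in> N\<close> and \<open>\<langle>T h, z h\<rangle> = \<parallel>h\<parallel>\<^sup>2 \<noteq> 0\<close>. So it is not invariant under \<open>T\<close>.\<close>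

subsection \<open>The Hardy space in terms of Taylor coefficients\<close>

lemma tcoeff_sums:
  assumes "f holomorphic_on disc" "cmod z < 1"
  shows "(\<lambda>n. tcoeff n f * z ^ n) sums f z"
  using holomorphic_power_series[OF assms(1), of z] assms(2) by (simp add: tcoeff_def)

text \<open>Coefficient formulas below are obtained by exhibiting a power series on the disc.
  Convergence at every real point of (0, 1) makes the radius of convergence at least 1, so the
  formal series is the expansion of \<open>f\<close> at 0.\<close>

lemma tcoeff_unique:
  assumes "\<And>z. cmod z < 1 \<Longrightarrow> (\<lambda>n. a n * z ^ n) sums f z"
  shows "tcoeff n f = a n"
proof -
  have rad: "fps_conv_radius (Abs_fps a) \<ge> 1"
    unfolding fps_conv_radius_def
  proof (rule conv_radius_geI_ex)
    fix r :: real assume "0 < r" "ereal r < 1"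
    then show "\<exists>z. norm z = r \<and> summable (\<lambda>n. fps_nth (Abs_fps a) n * z ^ n)"
      by (intro exI[of _ "complex_of_real r"]) (auto intro!: sums_summable[OF assms])
  qed
  have "eventually (\<lambda>z::complex. z \<in> disc) (nhds 0)"
    by (rule eventually_nhds_in_open) auto
  then have "eventually (\<lambda>z. eval_fps (Abs_fps a) z = f z) (nhds 0)"
    by eventually_elim (use assms in \<open>auto simp: eval_fps_def sums_iff\<close>)
  then have "f has_fps_expansion Abs_fps a"
    using rad by (auto simp: has_fps_expansion_def intro: less_le_trans[OF _ rad])
  from fps_nth_fps_expansion[OF this, of n] show ?thesis
    by (simp add: tcoeff_def)
qed

lemma powser_holomorphic_disc:
  assumes "\<And>z. cmod z < 1 \<Longrightarrow> (\<lambda>n. a n * z ^ n) sums f z"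
  shows "f holomorphic_on disc"
  by (rule power_series_holomorphic) (use assms in simp)

lemma H2_holo: "f \<in> H2 \<Longrightarrow> f holomorphic_on disc"
  and H2_outside: "f \<in> H2 \<Longrightarrow> \<not> cmod z < 1 \<Longrightarrow> f z = 0"
  and H2_summable: "f \<in> H2 \<Longrightarrow> summable (\<lambda>n. (cmod (tcoeff n f))\<^sup>2)"
  by (auto simp: H2_def)

lemma H2_sums: "f \<in> H2 \<Longrightarrow> cmod z < 1 \<Longrightarrow> (\<lambda>n. tcoeff n f * z ^ n) sums f z"
  by (rule tcoeff_sums[OF H2_holo])

lemma H2I:
  assumes "\<And>z. cmod z < 1 \<Longrightarrow> (\<lambda>n. a n * z ^ n) sums f z"
    and "\<And>z. \<not> cmod z < 1 \<Longrightarrow> f z = 0" and "summable (\<lambda>n. (cmod (a n))\<^sup>2)"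
  shows "f \<in> H2"
  using assms powser_holomorphic_disc[OF assms(1)] tcoeff_unique[OF assms(1)]
  by (auto simp: H2_def)

lemma H2_eqI:
  assumes "f \<in> H2" "g \<in> H2" "\<And>n. tcoeff n f = tcoeff n g"
  shows "f = g"
proof
  fix z show "f z = g z"
  proof (cases "cmod z < 1")
    case True
    then show ?thesis using H2_sums[OF assms(1) True] H2_sums[OF assms(2) True] assms(3)
      by (simp add: sums_iff)
  qed (simp add: H2_outside assms)
qed

text \<open>The inequality 2xy \<le> x^2 + y^2 dominates the terms by |a_n|^2 + |z|^(2n), a summable
  sequence plus a geometric one.\<close>

lemma square_summable_powser_sums:
  fixes a :: "nat \<Rightarrow> complex"
  assumes "summable (\<lambda>n. (cmod (a n))\<^sup>2)" "cmod z < 1"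
  shows "summable (\<lambda>n. a n * z ^ n)"
proof (rule summable_norm_cancel, rule summable_comparison_test)
  have "norm (norm (a n * z ^ n)) \<le> (cmod (a n))\<^sup>2 + ((cmod z)\<^sup>2) ^ n" for n
  proof -
    have "2 * (cmod (a n) * cmod z ^ n) \<le> (cmod (a n))\<^sup>2 + (cmod z ^ n)\<^sup>2"
      using sum_squares_bound[of "cmod (a n)" "cmod z ^ n"] by (simp add: mult.assoc)
    moreover have "0 \<le> cmod (a n) * cmod z ^ n" by simp
    moreover have "(cmod z ^ n)\<^sup>2 = ((cmod z)\<^sup>2) ^ n" by (simp add: power_mult[symmetric] mult.commute)
    ultimately have "cmod (a n) * cmod z ^ n \<le> (cmod (a n))\<^sup>2 + ((cmod z)\<^sup>2) ^ n" by linarith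
    then show ?thesis by (simp add: norm_mult norm_power)
  qed
  then show "\<exists>N. \<forall>n\<ge>N. norm (norm (a n * z ^ n)) \<le> (cmod (a n))\<^sup>2 + ((cmod z)\<^sup>2) ^ n" by blast
  have "(cmod z)\<^sup>2 < 1" using assms(2) by (simp add: power_less_one_iff)
  then show "summable (\<lambda>n. (cmod (a n))\<^sup>2 + ((cmod z)\<^sup>2) ^ n)"
    by (intro summable_add assms(1) summable_geometric) simp
qed

text \<open>Inverse of the coefficient map on square-summable sequences. The value 0 off the disc is
  the normalisation built into \<open>H2\<close>.\<close>

definition of_coeffs :: "(nat \<Rightarrow> complex) \<Rightarrow> complex \<Rightarrow> complex" where
  "of_coeffs a z = (if cmod z < 1 then \<Sum>n. a n * z ^ n else 0)"

lemma
  assumes "summable (\<lambda>n. (cmod (a n))\<^sup>2)"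
  shows of_coeffs_H2: "of_coeffs a \<in> H2"
    and tcoeff_of_coeffs: "tcoeff n (of_coeffs a) = a n"
proof -
  have s: "(\<lambda>n. a n * z ^ n) sums of_coeffs a z" if "cmod z < 1" for z
    using square_summable_powser_sums[OF assms that] that by (simp add: of_coeffs_def summable_sums)
  show "of_coeffs a \<in> H2" by (rule H2I[OF s]) (auto simp: of_coeffs_def assms)
  show "tcoeff n (of_coeffs a) = a n" by (rule tcoeff_unique[OF s])
qed

lemma summable_norm2_add:
  fixes a b :: "nat \<Rightarrow> complex"
  assumes "summable (\<lambda>n. (cmod (a n))\<^sup>2)" "summable (\<lambda>n. (cmod (b n))\<^sup>2)"
  shows "summable (\<lambda>n. (cmod (a n + b n))\<^sup>2)"
proof (rule summable_comparison_test)
  have "norm ((cmod (a n + b n))\<^sup>2) \<le> 2 * (cmod (a n))\<^sup>2 + 2 * (cmod (b n))\<^sup>2" for n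
  proof -
    have "(cmod (a n + b n))\<^sup>2 \<le> (cmod (a n) + cmod (b n))\<^sup>2"
      by (intro power_mono norm_triangle_ineq) simp
    then show ?thesis using sum_squares_bound[of "cmod (a n)" "cmod (b n)"] by (simp add: power2_sum)
  qed
  then show "\<exists>N. \<forall>n\<ge>N. norm ((cmod (a n + b n))\<^sup>2) \<le> 2 * (cmod (a n))\<^sup>2 + 2 * (cmod (b n))\<^sup>2" by blast
  show "summable (\<lambda>n. 2 * (cmod (a n))\<^sup>2 + 2 * (cmod (b n))\<^sup>2)"
    by (intro summable_add summable_mult assms)
qed

lemma
  assumes "f \<in> H2" "g \<in> H2"
  shows H2_add: "(\<lambda>z. f z + g z) \<in> H2"
    and tcoeff_add: "tcoeff n (\<lambda>z. f z + g z) = tcoeff n f + tcoeff n g"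
proof -
  have s: "(\<lambda>n. (tcoeff n f + tcoeff n g) * z ^ n) sums (f z + g z)" if "cmod z < 1" for z
    using sums_add[OF H2_sums[OF assms(1) that] H2_sums[OF assms(2) that]] by (simp add: ring_distribs)
  show "(\<lambda>z. f z + g z) \<in> H2"
    by (rule H2I[OF s]) (auto simp: H2_outside assms intro!: summable_norm2_add H2_summable)
  show "tcoeff n (\<lambda>z. f z + g z) = tcoeff n f + tcoeff n g" by (rule tcoeff_unique[OF s])
qed

lemma
  assumes "f \<in> H2"
  shows H2_scale: "(\<lambda>z. c * f z) \<in> H2"
    and tcoeff_scale: "tcoeff n (\<lambda>z. c * f z) = c * tcoeff n f"
proof -
  have s: "(\<lambda>n. (c * tcoeff n f) * z ^ n) sums (c * f z)" if "cmod z < 1" for z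
    using sums_mult[OF H2_sums[OF assms(1) that], of c] by (simp add: mult.assoc)
  show "(\<lambda>z. c * f z) \<in> H2"
    by (rule H2I[OF s]) (auto simp: H2_outside assms norm_mult power_mult_distrib intro!: summable_mult H2_summable)
  show "tcoeff n (\<lambda>z. c * f z) = c * tcoeff n f" by (rule tcoeff_unique[OF s])
qed

lemma
  assumes "f \<in> H2" "g \<in> H2"
  shows H2_diff: "(\<lambda>z. f z - g z) \<in> H2"
    and tcoeff_diff: "tcoeff n (\<lambda>z. f z - g z) = tcoeff n f - tcoeff n g"
  using H2_add[OF assms(1) H2_scale[OF assms(2), of "-1"]]
    tcoeff_add[OF assms(1) H2_scale[OF assms(2), of "-1"], of n] tcoeff_scale[OF assms(2), of n "-1"]
  by simp_all

lemma
  shows H2_zero: "(\<lambda>z. 0) \<in> H2" and tcoeff_zero: "tcoeff n (\<lambda>z. 0) = 0"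
proof -
  have s: "(\<lambda>n. 0 * z ^ n) sums 0" for z :: complex by simp
  show "(\<lambda>z. 0) \<in> H2" by (rule H2I[OF s]) auto
  show "tcoeff n (\<lambda>z. 0) = 0" using tcoeff_unique[where a = "\<lambda>_. 0" and f = "\<lambda>_. 0", OF s] by simp
qed

lemma
  assumes "f holomorphic_on disc"
  shows tcoeff_shift_0: "tcoeff 0 (\<lambda>z. z * f z) = 0"
    and tcoeff_shift_Suc: "tcoeff (Suc n) (\<lambda>z. z * f z) = tcoeff n f"
proof -
  define a where "a = (\<lambda>n. case n of 0 \<Rightarrow> 0 | Suc k \<Rightarrow> tcoeff k f)"
  have s: "(\<lambda>n. a n * z ^ n) sums (z * f z)" if "cmod z < 1" for z
  proof -
    have "(\<lambda>n. a (Suc n) * z ^ Suc n) sums (z * f z)"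
      using sums_mult[OF tcoeff_sums[OF assms that], of z] by (simp add: a_def algebra_simps)
    then show ?thesis by (subst (asm) sums_Suc_iff) (simp add: a_def)
  qed
  show "tcoeff 0 (\<lambda>z. z * f z) = 0" using tcoeff_unique[of a, OF s] by (simp add: a_def)
  show "tcoeff (Suc n) (\<lambda>z. z * f z) = tcoeff n f"
    using tcoeff_unique[of a, OF s] by (simp add: a_def)
qed

lemma H2_shift:
  assumes "f \<in> H2" shows "(\<lambda>z. z * f z) \<in> H2"
  using assms summable_Suc_iff[of "\<lambda>n. (cmod (tcoeff n (\<lambda>z. z * f z)))\<^sup>2"]
  by (auto simp: H2_def tcoeff_shift_Suc intro!: holomorphic_intros)

text \<open>The function (f(z) - f(0)) / z, given through its coefficients so that z = 0 needs no
  separate treatment.\<close>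

definition bshift :: "(complex \<Rightarrow> complex) \<Rightarrow> complex \<Rightarrow> complex" where
  "bshift f = of_coeffs (\<lambda>n. tcoeff (Suc n) f)"

lemma
  assumes "f \<in> H2"
  shows H2_bshift: "bshift f \<in> H2" and tcoeff_bshift: "tcoeff n (bshift f) = tcoeff (Suc n) f"
proof -
  have "summable (\<lambda>n. (cmod (tcoeff (Suc n) f))\<^sup>2)"
    using H2_summable[OF assms] by (subst summable_Suc_iff)
  then show "bshift f \<in> H2" "tcoeff n (bshift f) = tcoeff (Suc n) f"
    by (auto simp: bshift_def of_coeffs_H2 tcoeff_of_coeffs)
qed

section \<open>Inner product and norm of the Hardy space\<close>

lemma inner_terms_norm_summable:
  assumes "f \<in> H2" "g \<in> H2"
  shows "summable (\<lambda>n. cmod (tcoeff n f * cnj (tcoeff n g)))"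
proof (rule summable_comparison_test)
  have "norm (cmod (tcoeff n f * cnj (tcoeff n g))) \<le> (cmod (tcoeff n f))\<^sup>2 + (cmod (tcoeff n g))\<^sup>2" for n
  proof -
    have "2 * (cmod (tcoeff n f) * cmod (tcoeff n g)) \<le> (cmod (tcoeff n f))\<^sup>2 + (cmod (tcoeff n g))\<^sup>2"
      using sum_squares_bound[of "cmod (tcoeff n f)" "cmod (tcoeff n g)"] by (simp add: mult.assoc)
    moreover have "0 \<le> cmod (tcoeff n f) * cmod (tcoeff n g)" by simp
    ultimately have "cmod (tcoeff n f) * cmod (tcoeff n g) \<le> (cmod (tcoeff n f))\<^sup>2 + (cmod (tcoeff n g))\<^sup>2"
      by linarith
    then show ?thesis by (simp add: norm_mult)
  qed
  then show "\<exists>N. \<forall>n\<ge>N. norm (cmod (tcoeff n f * cnj (tcoeff n g))) \<le> (cmod (tcoeff n f))\<^sup>2 + (cmod (tcoeff n g))\<^sup>2"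
    by blast
qed (intro summable_add H2_summable assms)

lemma inner_sums:
  assumes "f \<in> H2" "g \<in> H2"
  shows "(\<lambda>n. tcoeff n f * cnj (tcoeff n g)) sums h2_inner f g"
  unfolding h2_inner_def
  by (rule summable_sums, rule summable_norm_cancel, rule inner_terms_norm_summable[OF assms])

lemma inner_add_left:
  assumes "f \<in> H2" "g \<in> H2" "h \<in> H2"
  shows "h2_inner (\<lambda>z. f z + g z) h = h2_inner f h + h2_inner g h"
  using sums_add[OF inner_sums[OF assms(1,3)] inner_sums[OF assms(2,3)]]
    inner_sums[OF H2_add[OF assms(1,2)] assms(3)]
  by (simp add: tcoeff_add assms ring_distribs sums_iff)

lemma inner_scale_left:
  assumes "f \<in> H2" "h \<in> H2"
  shows "h2_inner (\<lambda>z. c * f z) h = c * h2_inner f h"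
  using sums_mult[OF inner_sums[OF assms], of c] inner_sums[OF H2_scale[OF assms(1), of c] assms(2)]
  by (simp add: tcoeff_scale assms mult.assoc sums_iff)

lemma inner_commute:
  assumes "f \<in> H2" "h \<in> H2"
  shows "h2_inner f h = cnj (h2_inner h f)"
  using inner_sums[OF assms(2,1)] inner_sums[OF assms]
  by (subst (asm) sums_cnj[symmetric]) (simp add: mult.commute sums_iff)

lemma inner_add_right:
  assumes "f \<in> H2" "g \<in> H2" "h \<in> H2"
  shows "h2_inner h (\<lambda>z. f z + g z) = h2_inner h f + h2_inner h g"
  using inner_commute[OF assms(3) H2_add[OF assms(1,2)]] inner_commute[OF assms(3,1)]
    inner_commute[OF assms(3,2)] inner_add_left[OF assms] by simp

lemma inner_scale_right:
  assumes "f \<in> H2" "h \<in> H2"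
  shows "h2_inner h (\<lambda>z. c * f z) = cnj c * h2_inner h f"
  using inner_commute[OF assms(2) H2_scale[OF assms(1), of c]] inner_commute[OF assms(2,1)]
    inner_scale_left[OF assms, of c] by simp

lemma inner_diff_left:
  assumes "f \<in> H2" "g \<in> H2" "h \<in> H2"
  shows "h2_inner (\<lambda>z. f z - g z) h = h2_inner f h - h2_inner g h"
  using inner_add_left[OF assms(1) H2_scale[OF assms(2), of "-1"] assms(3)]
    inner_scale_left[OF assms(2,3), of "-1"] by simp

lemma inner_diff_right:
  assumes "f \<in> H2" "g \<in> H2" "h \<in> H2"
  shows "h2_inner h (\<lambda>z. f z - g z) = h2_inner h f - h2_inner h g"
  using inner_add_right[OF assms(1) H2_scale[OF assms(2), of "-1"] assms(3)]
    inner_scale_right[OF assms(2,3), of "-1"] by simp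

lemma inner_zero_left: "h2_inner (\<lambda>z. 0) h = 0"
  by (simp add: h2_inner_def tcoeff_zero)

text \<open>The zeroth term of the left series vanishes, and the rest is the right series with
  indices moved by one. This identifies \<open>bshift\<close> as the adjoint of the shift.\<close>

lemma inner_shift_bshift:
  assumes "f \<in> H2" "g \<in> H2"
  shows "h2_inner (\<lambda>z. z * f z) g = h2_inner f (bshift g)"
proof -
  let ?a = "\<lambda>n. tcoeff n (\<lambda>z. z * f z) * cnj (tcoeff n g)"
  have "(\<lambda>n. ?a (Suc n)) sums h2_inner f (bshift g)"
    using inner_sums[OF assms(1) H2_bshift[OF assms(2)]]
    by (simp add: H2_holo assms tcoeff_shift_Suc tcoeff_bshift)
  then have "?a sums (h2_inner f (bshift g) + ?a 0)" by (rule sums_Suc)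
  then show ?thesis using inner_sums[OF H2_shift[OF assms(1)] assms(2)]
    by (simp add: H2_holo assms tcoeff_shift_0 sums_iff)
qed

lemma bshift_shift: "f \<in> H2 \<Longrightarrow> bshift (\<lambda>z. z * f z) = f"
  by (rule H2_eqI) (simp_all add: H2_bshift H2_shift tcoeff_bshift tcoeff_shift_Suc H2_holo)

lemma inner_shift_shift:
  assumes "f \<in> H2" "g \<in> H2"
  shows "h2_inner (\<lambda>z. z * f z) (\<lambda>z. z * g z) = h2_inner f g"
  using inner_shift_bshift[OF assms(1) H2_shift[OF assms(2)]] bshift_shift[OF assms(2)] by simp

lemma norm_sq_sums:
  assumes "f \<in> H2"
  shows "(\<lambda>n. (cmod (tcoeff n f))\<^sup>2) sums (h2_norm f)\<^sup>2"
proof -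
  have e: "(\<lambda>n. complex_of_real ((cmod (tcoeff n f))\<^sup>2)) sums h2_inner f f"
    using inner_sums[OF assms assms] by (simp only: complex_norm_square)
  have r: "(\<lambda>n. (cmod (tcoeff n f))\<^sup>2) sums Re (h2_inner f f)"
    using sums_Re[OF e] by (simp del: of_real_power)
  moreover have "Re (h2_inner f f) \<ge> 0" by (rule sums_le[OF _ sums_zero r]) simp
  ultimately show ?thesis by (simp add: h2_norm_def)
qed

lemma inner_self:
  assumes "f \<in> H2"
  shows "h2_inner f f = complex_of_real ((h2_norm f)\<^sup>2)"
proof -
  have "(\<lambda>n. complex_of_real ((cmod (tcoeff n f))\<^sup>2)) sums h2_inner f f"
    using inner_sums[OF assms assms] by (simp only: complex_norm_square)
  moreover have "(\<lambda>n. complex_of_real ((cmod (tcoeff n f))\<^sup>2)) sums complex_of_real ((h2_norm f)\<^sup>2)"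
    using norm_sq_sums[OF assms] by (simp only: sums_of_real_iff)
  ultimately show ?thesis by (rule sums_unique2)
qed

lemma norm_nonneg: "f \<in> H2 \<Longrightarrow> h2_norm f \<ge> 0"
  using arg_cong[OF inner_self[of f], of Re] zero_le_power2[of "h2_norm f"]
  by (simp add: h2_norm_def del: zero_le_power2)

lemma inner_self_zero:
  assumes "f \<in> H2" "h2_inner f f = 0"
  shows "f = (\<lambda>z. 0)"
proof (rule H2_eqI[OF assms(1) H2_zero])
  fix n
  have "(\<lambda>n. (cmod (tcoeff n f))\<^sup>2) sums 0"
    using norm_sq_sums[OF assms(1)] inner_self[OF assms(1)] assms(2) by simp
  then have "\<forall>n. (cmod (tcoeff n f))\<^sup>2 = 0"
    by (subst suminf_eq_zero_iff[symmetric]) (auto simp: sums_iff)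
  then show "tcoeff n f = tcoeff n (\<lambda>z. 0)" by (simp add: tcoeff_zero)
qed

lemma inner_Cauchy_Schwarz:
  assumes "f \<in> H2" "g \<in> H2"
  shows "cmod (h2_inner f g) \<le> h2_norm f * h2_norm g"
proof -
  have L2: "L2_set (\<lambda>n. cmod (tcoeff n h)) {..<N} \<le> h2_norm h" if "h \<in> H2" for h N
  proof -
    have "(\<Sum>n<N. (cmod (tcoeff n h))\<^sup>2) \<le> (h2_norm h)\<^sup>2"
      using norm_sq_sums[OF that] sum_le_suminf[of "\<lambda>n. (cmod (tcoeff n h))\<^sup>2" "{..<N}"] by (simp add: sums_iff)
    then show ?thesis unfolding L2_set_def by (rule real_le_lsqrt[OF norm_nonneg[OF that]])
  qed
  have "cmod (h2_inner f g) \<le> (\<Sum>n. cmod (tcoeff n f * cnj (tcoeff n g)))"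
    unfolding h2_inner_def by (rule summable_norm[OF inner_terms_norm_summable[OF assms]])
  also have "\<dots> \<le> h2_norm f * h2_norm g"
  proof (rule suminf_le_const[OF inner_terms_norm_summable[OF assms]])
    fix N
    have "(\<Sum>n<N. cmod (tcoeff n f * cnj (tcoeff n g)))
        \<le> L2_set (\<lambda>n. cmod (tcoeff n f)) {..<N} * L2_set (\<lambda>n. cmod (tcoeff n g)) {..<N}"
      using L2_set_mult_ineq[of "\<lambda>n. cmod (tcoeff n f)" "\<lambda>n. cmod (tcoeff n g)" "{..<N}"] by (simp add: norm_mult)
    also have "\<dots> \<le> h2_norm f * h2_norm g"
      by (intro mult_mono L2 assms norm_nonneg L2_set_nonneg)
    finally show "(\<Sum>n<N. cmod (tcoeff n f * cnj (tcoeff n g))) \<le> h2_norm f * h2_norm g" .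
  qed
  finally show ?thesis .
qed

subsection \<open>Boundary values\<close>

lemma has_integral_cis:
  "((\<lambda>t. cis (of_int d * t)) has_integral (if d = 0 then 2 * pi else 0)) {0..2 * pi}"
proof (cases "d = 0")
  case True
  then show ?thesis using has_integral_const_real[of "1::complex" 0 "2*pi"] by (simp add: scaleR_conv_of_real)
next
  case False
  have "((\<lambda>t. cis (of_int d * t)) has_integral
      (cis (of_int d * (2 * pi)) / (\<i> * of_int d) - cis (of_int d * 0) / (\<i> * of_int d))) {0..2*pi}"
  proof (rule fundamental_theorem_of_calculus)
    fix t :: real
    have "((\<lambda>z. exp (\<i> * of_int d * z) / (\<i> * of_int d)) has_field_derivative exp (\<i> * of_int d * of_real t))
        (at (complex_of_real t))"
      using False by (auto intro!: derivative_eq_intros)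
    then have "((\<lambda>z. exp (\<i> * of_int d * z) / (\<i> * of_int d)) \<circ> complex_of_real has_vector_derivative
        exp (\<i> * of_int d * of_real t)) (at t within {0..2 * pi})"
      using has_vector_derivative_real_field has_vector_derivative_at_within by (simp add: o_def) blast
    then show "((\<lambda>t. cis (of_int d * t) / (\<i> * of_int d)) has_vector_derivative cis (of_int d * t)) (at t within {0..2 * pi})"
      by (simp add: o_def cis_conv_exp mult.assoc)
  qed simp
  moreover have "cis (of_int d * (2 * pi)) = 1"
    using cis_multiple_2pi[of "of_int d"] by (simp add: mult_ac)
  ultimately show ?thesis using False by simp
qed

lemma abs_summable_tcoeff:
  assumes "f holomorphic_on disc" "0 \<le> r" "r < 1"
  shows "summable (\<lambda>n. cmod (tcoeff n f) * r ^ n)"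
proof -
  \<comment> \<open>Any radius strictly between r and 1 would do: convergence at s gives absolute
    convergence at r.\<close>
  define s where "s = (1 + r) / 2"
  have "summable (\<lambda>n. tcoeff n f * complex_of_real s ^ n)"
  proof (rule sums_summable[OF tcoeff_sums[OF assms(1)]])
    have "\<bar>s\<bar> < 1" using assms by (simp add: s_def)
    then show "cmod (complex_of_real s) < 1" unfolding norm_of_real .
  qed
  then have "summable (\<lambda>n. norm (tcoeff n f * complex_of_real r ^ n))"
  proof (rule powser_insidea)
    have "\<bar>r\<bar> < \<bar>s\<bar>" using assms by (simp add: s_def)
    then show "norm (complex_of_real r) < norm (complex_of_real s)" unfolding norm_of_real .
  qed
  then show ?thesis using assms by (simp add: norm_mult norm_power)
qed

lemma circle_uniform_limit:
  assumes "f holomorphic_on disc" "0 \<le> r" "r < 1"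
  shows "uniform_limit X (\<lambda>N t. \<Sum>n<N. tcoeff n f * (of_real r * cis t) ^ n) (\<lambda>t. f (of_real r * cis t)) sequentially"
proof -
  have "uniform_limit X (\<lambda>N t. \<Sum>n<N. tcoeff n f * (of_real r * cis t) ^ n)
      (\<lambda>t. \<Sum>n. tcoeff n f * (of_real r * cis t) ^ n) sequentially"
    by (rule Weierstrass_m_test[OF _ abs_summable_tcoeff[OF assms]])
       (use assms in \<open>auto simp: norm_mult norm_power\<close>)
  moreover have "(\<Sum>n. tcoeff n f * (of_real r * cis t) ^ n) = f (of_real r * cis t)" for t
    using tcoeff_sums[OF assms(1), of "of_real r * cis t"] assms by (simp add: norm_mult sums_iff)
  ultimately show ?thesis by simp
qed

lemma circle_continuous:
  assumes "f holomorphic_on disc" "0 \<le> r" "r < 1"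
  shows "continuous_on X (\<lambda>t. f (of_real r * cis t))"
proof -
  have "(\<lambda>t. of_real r * cis t) ` X \<subseteq> disc" using assms by (auto simp: norm_mult)
  then show ?thesis
    by (intro continuous_on_compose2[OF holomorphic_on_imp_continuous_on[OF assms(1)]] continuous_intros)
qed

text \<open>In the product of two Taylor polynomials only the diagonal terms survive integration,
  because the integral of \<open>cis (d * t)\<close> vanishes for integers d \<noteq> 0. Uniform
  convergence on the circle carries this over to f and g.\<close>

lemma circle_parseval:
  assumes "f holomorphic_on disc" "g holomorphic_on disc" "0 \<le> r" "r < 1"
  shows "(\<lambda>n. tcoeff n f * cnj (tcoeff n g) * of_real (r ^ (2 * n))) sums
    (integral {0..2*pi} (\<lambda>t. f (of_real r * cis t) * cnj (g (of_real r * cis t))) / (2 * pi))"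
proof -
  let ?F = "\<lambda>N t. \<Sum>n<N. tcoeff n f * (of_real r * cis t) ^ n"
  let ?G = "\<lambda>N t. \<Sum>n<N. tcoeff n g * (of_real r * cis t) ^ n"
  let ?X = "{0..2*pi}"
  have bdd: "bounded ((\<lambda>t. h (complex_of_real r * cis t)) ` ?X)" if "h holomorphic_on disc" for h
    using compact_imp_bounded[OF compact_continuous_image[OF circle_continuous[OF that assms(3,4), of ?X]]] by simp
  have "uniform_limit ?X ?G (\<lambda>t. g (of_real r * cis t)) sequentially"
    by (rule circle_uniform_limit) fact+
  then have uG: "uniform_limit ?X (\<lambda>N t. cnj (?G N t)) (\<lambda>t. cnj (g (of_real r * cis t))) sequentially"
    by (rule bounded_linear.uniform_limit[OF bounded_linear_cnj])
  have bG: "bounded ((\<lambda>t. cnj (g (of_real r * cis t))) ` ?X)"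
    using bdd[OF assms(2)] by (auto simp: bounded_iff)
  have u: "uniform_limit ?X (\<lambda>N t. ?F N t * cnj (?G N t))
      (\<lambda>t. f (of_real r * cis t) * cnj (g (of_real r * cis t))) sequentially"
    by (rule uniform_lim_mult[OF circle_uniform_limit[OF assms(1,3,4)] uG bdd[OF assms(1)] bG])
  obtain I J where I: "\<And>N. ((\<lambda>t. ?F N t * cnj (?G N t)) has_integral I N) ?X"
    and J: "((\<lambda>t. f (of_real r * cis t) * cnj (g (of_real r * cis t))) has_integral J) ?X"
    and IJ: "I \<longlonglongrightarrow> J"
    by (rule uniform_limit_integral[OF u]) (auto intro!: continuous_intros)
  have "I N = 2 * pi * (\<Sum>n<N. tcoeff n f * cnj (tcoeff n g) * of_real (r ^ (2 * n)))" for N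
  proof -
    let ?c = "\<lambda>n k. tcoeff n f * cnj (tcoeff k g) * of_real (r ^ (n + k))"
    have "((\<lambda>t. \<Sum>n<N. \<Sum>k<N. ?c n k * cis (of_int (int n - int k) * t)) has_integral
       (\<Sum>n<N. \<Sum>k<N. ?c n k * (if int n - int k = 0 then 2 * pi else 0))) ?X"
      by (intro has_integral_sum has_integral_mult_right has_integral_cis finite_lessThan)
    also have "(\<lambda>t. \<Sum>n<N. \<Sum>k<N. ?c n k * cis (of_int (int n - int k) * t)) = (\<lambda>t. ?F N t * cnj (?G N t))"
    proof
      fix t
      have c: "cis (of_int (int n - int k) * t) = cis t ^ n * cnj (cis t) ^ k" for n k
      proof -
        have "cis t ^ n * cis (- t) ^ k = cis (real n * t + real k * (- t))"
          by (simp only: Complex.DeMoivre cis_mult)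
        also have "real n * t + real k * (- t) = of_int (int n - int k) * t" by (simp add: algebra_simps)
        finally show ?thesis unfolding cis_cnj by (rule sym)
      qed
      show "(\<Sum>n<N. \<Sum>k<N. ?c n k * cis (of_int (int n - int k) * t)) = ?F N t * cnj (?G N t)"
        unfolding sum_product cnj_sum c
        by (intro sum.cong refl)
           (simp only: power_mult_distrib power_add of_real_power of_real_mult complex_cnj_mult complex_cnj_power
             complex_cnj_complex_of_real mult_ac)
    qed
    also have "(\<Sum>n<N. \<Sum>k<N. ?c n k * (if int n - int k = 0 then 2 * pi else 0))
        = (\<Sum>n<N. \<Sum>k<N. if k = n then 2 * pi * ?c n n else 0)"
    proof (intro sum.cong refl)
      fix n k
      show "?c n k * (if int n - int k = 0 then 2 * pi else 0) = (if k = n then 2 * pi * ?c n n else 0)"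
        by (cases "k = n") (simp_all add: mult.commute)
    qed
    also have "\<dots> = (\<Sum>n<N. 2 * pi * ?c n n)"
      by (intro sum.cong refl) (simp add: sum.delta)
    also have "\<dots> = 2 * pi * (\<Sum>n<N. tcoeff n f * cnj (tcoeff n g) * of_real (r ^ (2 * n)))"
      unfolding mult_2[symmetric] by (rule sum_distrib_left[symmetric])
    finally show ?thesis using has_integral_unique[OF I] by blast
  qed
  then have "(\<lambda>N. I N / (2 * pi)) = (\<lambda>N. \<Sum>n<N. tcoeff n f * cnj (tcoeff n g) * of_real (r ^ (2 * n)))"
    by auto
  moreover have "(\<lambda>N. I N / (2 * pi)) \<longlonglongrightarrow> J / (2 * pi)" by (intro tendsto_intros IJ) simp
  ultimately show ?thesis using integral_unique[OF J] by (simp add: sums_def)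
qed

text \<open>Parseval on the circle of radius r bounds the partial sums with weights r^(2n) by C^2.
  For fixed N the weights disappear as r tends to 1.\<close>

lemma bounded_holo_summable:
  assumes "m \<in> Hinf"
  shows "summable (\<lambda>n. (cmod (tcoeff n m))\<^sup>2)"
proof -
  have holo: "m holomorphic_on disc" using assms by (simp add: Hinf_def)
  obtain C where C: "\<And>z. cmod z < 1 \<Longrightarrow> cmod (m z) \<le> C"
    using assms unfolding Hinf_def bounded_iff by force
  have fin: "(\<Sum>n<N. (cmod (tcoeff n m))\<^sup>2 * r ^ (2 * n)) \<le> C\<^sup>2" if r: "0 \<le> r" "r < 1" for r N
  proof -
    let ?I = "integral {0..2*pi} (\<lambda>t. m (of_real r * cis t) * cnj (m (of_real r * cis t)))"
    have s: "(\<lambda>n. complex_of_real ((cmod (tcoeff n m))\<^sup>2 * r ^ (2 * n))) sums (?I / (2 * pi))"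
      using circle_parseval[OF holo holo r] by (simp only: of_real_mult complex_norm_square)
    have "cmod ?I \<le> integral {0..2*pi} (\<lambda>t. C\<^sup>2)"
    proof (rule integral_norm_bound_integral)
      show "(\<lambda>t. m (of_real r * cis t) * cnj (m (of_real r * cis t))) integrable_on {0..2*pi}"
        by (intro integrable_continuous_real continuous_intros circle_continuous holo r)
      fix t
      have "cmod (m (of_real r * cis t)) \<le> C" by (rule C) (use r in \<open>simp add: norm_mult\<close>)
      then show "cmod (m (of_real r * cis t) * cnj (m (of_real r * cis t))) \<le> C\<^sup>2"
        unfolding norm_mult complex_mod_cnj power2_eq_square
        by (intro mult_mono) (auto intro: order_trans[OF norm_ge_zero])
    qed auto
    then have "cmod (?I / (2 * pi)) \<le> C\<^sup>2" by (simp add: norm_divide norm_mult divide_le_eq mult_ac)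
    then have le: "Re (?I / (2 * pi)) \<le> C\<^sup>2" using complex_Re_le_cmod order_trans by blast
    have s': "(\<lambda>n. (cmod (tcoeff n m))\<^sup>2 * r ^ (2 * n)) sums Re (?I / (2 * pi))"
      using sums_Re[OF s] by (simp only: Re_complex_of_real)
    have "(\<Sum>n<N. (cmod (tcoeff n m))\<^sup>2 * r ^ (2 * n)) \<le> (\<Sum>n. (cmod (tcoeff n m))\<^sup>2 * r ^ (2 * n))"
      by (rule sum_le_suminf) (use s' r in \<open>auto simp: sums_iff\<close>)
    with s' le show ?thesis by (simp add: sums_iff)
  qed
  have "(\<Sum>n<N. (cmod (tcoeff n m))\<^sup>2) \<le> C\<^sup>2" for N
  proof (rule tendsto_le[of "at_left (1::real)"])
    show "((\<lambda>r. \<Sum>n<N. (cmod (tcoeff n m))\<^sup>2 * r ^ (2 * n)) \<longlongrightarrow> (\<Sum>n<N. (cmod (tcoeff n m))\<^sup>2)) (at_left 1)"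
      by (auto intro!: tendsto_eq_intros)
    have "eventually (\<lambda>r::real. r \<in> {0<..<1}) (at_left 1)"
      by (rule eventually_at_leftI[of 0]) auto
    then show "eventually (\<lambda>r. (\<Sum>n<N. (cmod (tcoeff n m))\<^sup>2 * r ^ (2 * n)) \<le> C\<^sup>2) (at_left 1)"
      by eventually_elim (auto intro: fin)
  qed auto
  then have "(\<Sum>n\<le>N. (cmod (tcoeff n m))\<^sup>2) \<le> C\<^sup>2" for N
    unfolding lessThan_Suc_atMost[symmetric] .
  then show ?thesis by (rule bounded_imp_summable[rotated]) simp
qed

text \<open>Abel summation: absolute summability makes the series in r converge uniformly on the
  closed interval [0, 1], so its sum is continuous up to r = 1. A sequence of radii is used because
  dominated convergence is applied to sequences.\<close>

lemma inner_radial_limit: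
  assumes "f \<in> H2" "g \<in> H2"
  shows "(\<lambda>k. \<Sum>n. tcoeff n f * cnj (tcoeff n g) * of_real ((1 - inverse (real (Suc k))) ^ (2 * n)))
    \<longlonglongrightarrow> h2_inner f g"
proof -
  let ?c = "\<lambda>n. tcoeff n f * cnj (tcoeff n g)"
  let ?h = "\<lambda>r::real. \<Sum>n. ?c n * of_real (r ^ (2 * n))"
  let ?r = "\<lambda>k. 1 - inverse (real (Suc k))"
  have r: "?r k \<in> {0..1}" for k by (simp add: inverse_le_1_iff)
  have "uniform_limit {0..1} (\<lambda>N r. \<Sum>n<N. ?c n * of_real (r ^ (2 * n))) ?h sequentially"
  proof (rule Weierstrass_m_test[OF _ inner_terms_norm_summable[OF assms]])
    fix n and r :: real assume "r \<in> {0..1}"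
    then have "\<bar>r\<bar> ^ (2 * n) \<le> 1" by (intro power_le_one) auto
    then show "norm (?c n * of_real (r ^ (2 * n))) \<le> cmod (?c n)"
      by (simp add: norm_mult norm_power mult_left_le)
  qed
  then have cont: "continuous_on {0..1} ?h"
    by (rule uniform_limit_theorem[rotated]) (auto intro!: continuous_intros always_eventually)
  have "(\<lambda>k. ?r k) \<longlonglongrightarrow> 1"
    using tendsto_diff[OF tendsto_const LIMSEQ_inverse_real_of_nat, of 1] by simp
  then have "(\<lambda>k. ?h (?r k)) \<longlonglongrightarrow> ?h 1"
    by (rule continuous_on_tendsto_compose[OF cont]) (use r in auto)
  then show ?thesis by (simp add: h2_inner_def)
qed

text \<open>Dominated convergence on the circles of radius tending to 1 turns the almost everywhere
  condition on the boundary values into a statement about Taylor coefficients.\<close>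
lemma inner_fun_orthonormal:
  assumes "inner_fun m" "m \<in> H2" "(\<lambda>z. z ^ d * m z) \<in> H2"
  shows "h2_inner (\<lambda>z. z ^ d * m z) m = (if d = 0 then 1 else 0)"
proof -
  let ?f = "\<lambda>z. z ^ d * m z"
  let ?r = "\<lambda>k. 1 - inverse (real (Suc k))"
  let ?S = "{0..2*pi}"
  have r: "0 \<le> ?r k" "?r k < 1" for k by (simp_all add: inverse_le_1_iff)
  have rlim: "(\<lambda>k. ?r k) \<longlonglongrightarrow> 1"
    using tendsto_diff[OF tendsto_const LIMSEQ_inverse_real_of_nat, of 1] by simp
  note holo = H2_holo[OF assms(3)] H2_holo[OF assms(2)]
  define s where "s k t = ?f (of_real (?r k) * cis t) * cnj (m (of_real (?r k) * cis t))" for k t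
  obtain C where C: "\<And>z. cmod z < 1 \<Longrightarrow> cmod (m z) \<le> C"
    using assms(1) unfolding inner_fun_def Hinf_def bounded_iff by force
  have si: "set_integrable lborel ?S (s k)" for k
    unfolding s_def
    by (intro borel_integrable_atLeastAtMost' continuous_on_mult continuous_on_cnj circle_continuous holo r)
  have ci: "set_integrable lborel ?S (\<lambda>t. cis (real d * t))"
    by (intro borel_integrable_atLeastAtMost' continuous_intros)
  have "(\<lambda>k. LINT t:?S|lborel. s k t) \<longlonglongrightarrow> (LINT t:?S|lborel. cis (real d * t))"
    unfolding set_lebesgue_integral_def
  \<comment> \<open>The constant C^2 dominates since |z^d| \<le> 1 and |m| \<le> C on the
    disc.\<close>
  proof (rule integral_dominated_convergence[where w = "\<lambda>t. indicator ?S t * C\<^sup>2"])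
    show "(\<lambda>t. indicat_real ?S t *\<^sub>R cis (real d * t)) \<in> borel_measurable lborel"
      using ci unfolding set_integrable_def by (rule borel_measurable_integrable)
    show "(\<lambda>t. indicat_real ?S t *\<^sub>R s k t) \<in> borel_measurable lborel" for k
      using si[of k] unfolding set_integrable_def by (rule borel_measurable_integrable)
    show "integrable lborel (\<lambda>t. indicator ?S t * C\<^sup>2)"
      by (intro integrable_mult_left integrable_real_indicator) (auto simp: emeasure_lborel_Icc)
    show "AE t in lborel. norm (indicat_real ?S t *\<^sub>R s k t) \<le> indicator ?S t * C\<^sup>2" for k
    proof (rule AE_I2)
      fix t
      have "cmod (m (of_real (?r k) * cis t)) \<le> C"
        by (intro C) (simp only: norm_mult norm_of_real norm_cis abs_of_nonneg[OF r(1)] mult_1_right r(2))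
      moreover have "cmod (of_real (?r k) * cis t) ^ d \<le> 1"
        by (intro power_le_one norm_ge_zero)
           (simp only: norm_mult norm_of_real norm_cis abs_of_nonneg[OF r(1)] mult_1_right less_imp_le[OF r(2)])
      ultimately have "cmod (of_real (?r k) * cis t) ^ d *
          (cmod (m (of_real (?r k) * cis t)) * cmod (m (of_real (?r k) * cis t))) \<le> 1 * (C * C)"
        by (intro mult_mono) (auto intro: order_trans[OF norm_ge_zero])
      then have "cmod (s k t) \<le> C\<^sup>2"
        unfolding s_def norm_mult norm_power complex_mod_cnj power2_eq_square by (simp only: mult.assoc mult_1_left)
      then show "norm (indicat_real ?S t *\<^sub>R s k t) \<le> indicator ?S t * C\<^sup>2"
        by (auto simp: indicator_def)
    qed
    have ae: "AE t in lborel. t \<in> ?S \<longrightarrow>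
        (\<exists>L. cmod L = 1 \<and> ((\<lambda>r. m (complex_of_real r * cis t)) \<longlongrightarrow> L) (at_left 1))"
      using assms(1) by (simp add: inner_fun_def)
    show "AE t in lborel. (\<lambda>k. indicat_real ?S t *\<^sub>R s k t) \<longlonglongrightarrow> indicat_real ?S t *\<^sub>R cis (real d * t)"
      using ae
    proof (rule AE_mp, intro AE_I2 impI)
      fix t assume ex: "t \<in> ?S \<longrightarrow>
        (\<exists>L. cmod L = 1 \<and> ((\<lambda>r. m (complex_of_real r * cis t)) \<longlongrightarrow> L) (at_left 1))"
      show "(\<lambda>k. indicat_real ?S t *\<^sub>R s k t) \<longlonglongrightarrow> indicat_real ?S t *\<^sub>R cis (real d * t)"
      proof (cases "t \<in> ?S")
        case True
        then obtain L where L: "cmod L = 1" "((\<lambda>r. m (complex_of_real r * cis t)) \<longlongrightarrow> L) (at_left 1)"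
          using ex by blast
        have "filterlim (\<lambda>k. ?r k) (at_left 1) sequentially"
          using rlim r by (auto simp: filterlim_at intro!: always_eventually)
        from filterlim_compose[OF L(2) this]
        have mL: "(\<lambda>k. m (complex_of_real (?r k) * cis t)) \<longlonglongrightarrow> L" .
        have "s k t = (of_real (?r k) * cis t) ^ d * m (of_real (?r k) * cis t) * cnj (m (of_real (?r k) * cis t))" for k
          by (simp add: s_def)
        moreover have "(\<lambda>k. (of_real (?r k) * cis t) ^ d * m (of_real (?r k) * cis t) * cnj (m (of_real (?r k) * cis t)))
            \<longlonglongrightarrow> (of_real 1 * cis t) ^ d * L * cnj L"
          by (intro tendsto_intros mL rlim)
        \<comment> \<open>The boundary value L is unimodular, so L * cnj L = 1 and only the
          character of index d is left.\<close>
        moreover have "(of_real 1 * cis t) ^ d * L * cnj L = cis (real d * t)"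
          using L(1) complex_norm_square[of L] by (simp add: Complex.DeMoivre mult.assoc)
        ultimately have "(\<lambda>k. s k t) \<longlonglongrightarrow> cis (real d * t)" by simp
        then show ?thesis using True by simp
      qed simp
    qed
  qed
  moreover have "(LINT t:?S|lborel. cis (real d * t)) = (if d = 0 then 2 * pi else 0)"
    using set_borel_integral_eq_integral(2)[OF ci] integral_unique[OF has_integral_cis[of "int d"]] by simp
  moreover have "(LINT t:?S|lborel. s k t) = 2 * pi *
     (\<Sum>n. tcoeff n ?f * cnj (tcoeff n m) * of_real (?r k ^ (2 * n)))" for k
  proof -
    have "(\<Sum>n. tcoeff n ?f * cnj (tcoeff n m) * of_real (?r k ^ (2 * n))) = integral ?S (s k) / (2 * pi)"
      using sums_unique[OF circle_parseval[OF holo r[of k]]] unfolding s_def by (rule sym)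
    then show ?thesis using set_borel_integral_eq_integral(2)[OF si[of k]] by (simp del: of_real_power)
  qed
  ultimately have "(\<lambda>k. 2 * pi * (\<Sum>n. tcoeff n ?f * cnj (tcoeff n m) * of_real (?r k ^ (2 * n))))
     \<longlonglongrightarrow> (if d = 0 then 2 * pi else 0)" by (simp del: of_real_power)
  moreover have "(\<lambda>k. 2 * pi * (\<Sum>n. tcoeff n ?f * cnj (tcoeff n m) * of_real (?r k ^ (2 * n))))
     \<longlonglongrightarrow> 2 * pi * h2_inner ?f m"
    by (intro tendsto_intros inner_radial_limit assms)
  ultimately have "2 * pi * h2_inner ?f m = (if d = 0 then 2 * pi else 0)"
    using LIMSEQ_unique by blast
  then show ?thesis by (simp split: if_splits)
qed

section \<open>Finite sums, monomials and Taylor polynomials in the Hardy space\<close>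

lemma
  assumes "finite A" "\<And>k. k \<in> A \<Longrightarrow> f k \<in> H2"
  shows H2_sum: "(\<lambda>z. \<Sum>k\<in>A. f k z) \<in> H2"
    and tcoeff_sum: "tcoeff n (\<lambda>z. \<Sum>k\<in>A. f k z) = (\<Sum>k\<in>A. tcoeff n (f k))"
proof -
  have "(\<lambda>z. \<Sum>k\<in>A. f k z) \<in> H2 \<and> tcoeff n (\<lambda>z. \<Sum>k\<in>A. f k z) = (\<Sum>k\<in>A. tcoeff n (f k))"
    using assms by (induction A rule: finite_induct) (simp_all add: H2_zero tcoeff_zero H2_add tcoeff_add)
  then show "(\<lambda>z. \<Sum>k\<in>A. f k z) \<in> H2" "tcoeff n (\<lambda>z. \<Sum>k\<in>A. f k z) = (\<Sum>k\<in>A. tcoeff n (f k))"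
    by auto
qed

lemma inner_sum_left:
  assumes "finite A" "\<And>k. k \<in> A \<Longrightarrow> f k \<in> H2" "h \<in> H2"
  shows "h2_inner (\<lambda>z. \<Sum>k\<in>A. f k z) h = (\<Sum>k\<in>A. h2_inner (f k) h)"
  using assms(1,2)
proof (induction A rule: finite_induct)
  case (insert x F)
  then have "(\<lambda>z. \<Sum>k\<in>F. f k z) \<in> H2" by (intro H2_sum) auto
  with insert show ?case using inner_add_left[of "f x" "\<lambda>z. \<Sum>k\<in>F. f k z" h] assms(3) by simp
qed (simp add: inner_zero_left)

lemma inner_sum_right:
  assumes "finite A" "\<And>k. k \<in> A \<Longrightarrow> f k \<in> H2" "h \<in> H2"
  shows "h2_inner h (\<lambda>z. \<Sum>k\<in>A. f k z) = (\<Sum>k\<in>A. h2_inner h (f k))"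
proof -
  have "h2_inner h (\<lambda>z. \<Sum>k\<in>A. f k z) = cnj (\<Sum>k\<in>A. h2_inner (f k) h)"
    using inner_commute[OF assms(3) H2_sum[of A f]] inner_sum_left[of A f h] assms by simp
  also have "\<dots> = (\<Sum>k\<in>A. h2_inner h (f k))"
    unfolding cnj_sum by (intro sum.cong refl inner_commute[symmetric] assms)
  finally show ?thesis .
qed

text \<open>Monomials are set to 0 off the disc because z^k itself violates the normalisation of
  \<open>H2\<close>.\<close>

definition disc_power :: "nat \<Rightarrow> complex \<Rightarrow> complex" where
  "disc_power k z = (if cmod z < 1 then z ^ k else 0)"

lemma
  shows disc_power_H2: "disc_power k \<in> H2"
    and tcoeff_disc_power: "tcoeff n (disc_power k) = (if n = k then 1 else 0)"
proof -
  have s: "(\<lambda>n. (if n = k then 1 else 0) * z ^ n) sums disc_power k z" if "cmod z < 1" for z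
    using sums_single[of k "\<lambda>n. z ^ n"] that by (simp add: disc_power_def if_distrib[of "\<lambda>x. x * _"] cong: if_cong)
  have "summable (\<lambda>n. (cmod (if n = k then 1 else 0))\<^sup>2)"
    by (rule summable_finite[of "{k}"]) auto
  then show "disc_power k \<in> H2" by (intro H2I[OF s]) (auto simp: disc_power_def)
  show "tcoeff n (disc_power k) = (if n = k then 1 else 0)"
    using tcoeff_unique[where a = "\<lambda>n. if n = k then 1 else 0", OF s] by simp
qed

lemma shift_disc_power: "z * disc_power k z = disc_power (Suc k) z"
  by (simp add: disc_power_def)

lemma inner_disc_power_left:
  assumes "f \<in> H2" shows "h2_inner (disc_power k) f = cnj (tcoeff k f)"
proof -
  have "h2_inner (disc_power k) f = (\<Sum>n. if n = k then cnj (tcoeff n f) else 0)"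
    unfolding h2_inner_def tcoeff_disc_power by (intro arg_cong[of _ _ suminf]) auto
  then show ?thesis using sums_unique[OF sums_single[of k "\<lambda>n. cnj (tcoeff n f)"]] by simp
qed

lemma shift_bshift:
  assumes "f \<in> H2"
  shows "z * bshift f z = f z - tcoeff 0 f * disc_power 0 z"
proof -
  have "(\<lambda>z. z * bshift f z) = (\<lambda>z. f z - tcoeff 0 f * disc_power 0 z)"
  proof (rule H2_eqI)
    fix n
    show "tcoeff n (\<lambda>z. z * bshift f z) = tcoeff n (\<lambda>z. f z - tcoeff 0 f * disc_power 0 z)"
      by (cases n) (simp_all add: assms H2_scale disc_power_H2 tcoeff_diff tcoeff_scale tcoeff_disc_power
        tcoeff_shift_0 tcoeff_shift_Suc H2_holo H2_bshift tcoeff_bshift)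
  qed (intro H2_shift H2_bshift H2_diff H2_scale disc_power_H2 assms)+
  then show ?thesis by (rule fun_cong)
qed

lemma H2_tail:
  assumes "g \<in> H2"
  shows "(\<lambda>z. g z - (\<Sum>k<N. tcoeff k g * disc_power k z)) \<in> H2"
  by (intro H2_diff H2_sum H2_scale disc_power_H2 assms) auto

text \<open>The squared norm of a Taylor remainder is the squared norm of g minus a partial sum of
  its squared coefficients. This is the density of polynomials in the Hardy space.\<close>

lemma tail_norm_tendsto_0:
  assumes "g \<in> H2"
  shows "(\<lambda>N. h2_norm (\<lambda>z. g z - (\<Sum>k<N. tcoeff k g * disc_power k z))) \<longlonglongrightarrow> 0"
proof -
  let ?t = "\<lambda>N z. g z - (\<Sum>k<N. tcoeff k g * disc_power k z)"
  let ?a = "\<lambda>n. (cmod (tcoeff n g))\<^sup>2"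
  have c: "tcoeff n (?t N) = (if n < N then 0 else tcoeff n g)" for n N
  proof -
    have "tcoeff n (?t N) = tcoeff n g - (\<Sum>k<N. tcoeff k g * (if n = k then 1 else 0))"
      using assms by (subst tcoeff_diff) (auto simp: tcoeff_sum H2_sum H2_scale disc_power_H2 tcoeff_scale tcoeff_disc_power)
    then show ?thesis by (simp add: if_distrib[of "\<lambda>x. _ * x"] cong: if_cong)
  qed
  have "(h2_norm (?t N))\<^sup>2 = (h2_norm g)\<^sup>2 - sum ?a {..<N}" for N
  proof -
    have "(\<lambda>n. ?a n - (if n \<in> {..<N} then ?a n else 0)) sums ((h2_norm g)\<^sup>2 - sum ?a {..<N})"
      by (intro sums_diff norm_sq_sums assms sums_If_finite_set) auto
    moreover have "(\<lambda>n. ?a n - (if n \<in> {..<N} then ?a n else 0)) = (\<lambda>n. (cmod (tcoeff n (?t N)))\<^sup>2)"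
      by (auto simp: c)
    ultimately show ?thesis using sums_unique2[OF norm_sq_sums[OF H2_tail[OF assms, of N]]] by simp
  qed
  moreover have "(\<lambda>N. (h2_norm g)\<^sup>2 - sum ?a {..<N}) \<longlonglongrightarrow> (h2_norm g)\<^sup>2 - (h2_norm g)\<^sup>2"
    using norm_sq_sums[OF assms] unfolding sums_def by (intro tendsto_diff tendsto_const)
  ultimately have "(\<lambda>N. (h2_norm (?t N))\<^sup>2) \<longlonglongrightarrow> 0" by simp
  then have "(\<lambda>N. sqrt ((h2_norm (?t N))\<^sup>2)) \<longlonglongrightarrow> sqrt 0" by (rule tendsto_real_sqrt)
  then show ?thesis by (simp add: norm_nonneg[OF H2_tail[OF assms]])
qed

lemma tcoeff_mult:
  assumes "f holomorphic_on disc" "g holomorphic_on disc"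
  shows "tcoeff n (\<lambda>z. f z * g z) = (\<Sum>i\<le>n. tcoeff i f * tcoeff (n - i) g)"
proof (rule tcoeff_unique)
  fix z :: complex assume z: "cmod z < 1"
  have "summable (\<lambda>k. norm (tcoeff k h * z ^ k))" if "h holomorphic_on disc" for h
    using abs_summable_tcoeff[OF that, of "cmod z"] z by (simp add: norm_mult norm_power)
  from Cauchy_product_sums[OF this[OF assms(1)] this[OF assms(2)]]
  have "(\<lambda>k. \<Sum>i\<le>k. tcoeff i f * z ^ i * (tcoeff (k - i) g * z ^ (k - i))) sums (f z * g z)"
    using tcoeff_sums[OF assms(1) z] tcoeff_sums[OF assms(2) z] by (simp add: sums_iff)
  also have "(\<lambda>k. \<Sum>i\<le>k. tcoeff i f * z ^ i * (tcoeff (k - i) g * z ^ (k - i)))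
      = (\<lambda>k. (\<Sum>i\<le>k. tcoeff i f * tcoeff (k - i) g) * z ^ k)"
    unfolding sum_distrib_right
    by (intro ext sum.cong refl) (simp add: mult_ac power_add[symmetric])
  finally show "(\<lambda>k. (\<Sum>i\<le>k. tcoeff i f * tcoeff (k - i) g) * z ^ k) sums (f z * g z)" .
qed

subsection \<open>The model space and its compressed shift\<close>

text \<open>Vanishing off the disc makes m itself an element of \<open>H2\<close>, so that vectors
  are equal as soon as their coefficients are. A general inner function is reduced to this case by
  \<open>cutoff\<close>.\<close>

locale disc_inner_fun =
  fixes m :: "complex \<Rightarrow> complex"
  assumes inner: "inner_fun m" and outside: "\<And>z. \<not> cmod z < 1 \<Longrightarrow> m z = 0"
begin

lemma m_H2: "m \<in> H2"
  using inner bounded_holo_summable[of m] outside by (auto simp: inner_fun_def H2_def Hinf_def)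

definition mz :: "nat \<Rightarrow> complex \<Rightarrow> complex" where "mz j z = z ^ j * m z"

lemma mz_0: "mz 0 = m" and shift_mz: "z * mz j z = mz (Suc j) z"
  by (auto simp: mz_def)

lemma mz_H2: "mz j \<in> H2"
proof (induction j)
  case (Suc j)
  from H2_shift[OF this] show ?case by (simp add: shift_mz)
qed (simp add: mz_0 m_H2)

lemma tcoeff_mz: "tcoeff n (mz j) = (if n < j then 0 else tcoeff (n - j) m)"
proof (induction j arbitrary: n)
  case (Suc j)
  have "tcoeff n (mz (Suc j)) = tcoeff n (\<lambda>z. z * mz j z)" by (simp add: shift_mz)
  then show ?case
    by (cases n) (simp_all add: H2_holo mz_H2 tcoeff_shift_0 tcoeff_shift_Suc Suc)
qed (simp add: mz_0)

text \<open>The shift is an isometry, so only the difference d of the exponents matters. The pairing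
  of z^d m with m is the place where innerness enters, through
  \<open>inner_fun_orthonormal\<close>.\<close>

lemma inner_mz_mz: "h2_inner (mz j) (mz k) = (if j = k then 1 else 0)"
proof -
  have step: "h2_inner (mz (Suc j)) (mz (Suc k)) = h2_inner (mz j) (mz k)" for j k
    using inner_shift_shift[OF mz_H2 mz_H2, of j k] by (simp add: shift_mz)
  have base: "h2_inner (mz d) (mz 0) = (if d = 0 then 1 else 0)" for d
  proof -
    have "mz d = (\<lambda>z. z ^ d * m z)" by (auto simp: mz_def)
    then show ?thesis using inner_fun_orthonormal[OF inner m_H2, of d] mz_H2[of d] by (simp only: mz_0)
  qed
  have ge: "h2_inner (mz (k + d)) (mz k) = (if d = 0 then 1 else 0)" for k d
    by (induction k) (simp_all add: base step)
  show ?thesis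
  proof (cases "k \<le> j")
    case True
    then show ?thesis using ge[of k "j - k"] by auto
  next
    case False
    then show ?thesis using ge[of j "k - j"] inner_commute[OF mz_H2 mz_H2, of j k] by auto
  qed
qed

lemma inner_m_m: "h2_inner m m = 1"
  using inner_mz_mz[of 0 0] by (simp add: mz_0)

text \<open>The first \<open>N\<close> Taylor coefficients of \<open>m g\<close> depend only on those of \<open>g\<close>, so the bound for
  polynomials passes to all \<open>g\<close>.\<close>
lemma
  assumes g: "g \<in> H2"
  shows mult_H2: "(\<lambda>z. m z * g z) \<in> H2" and norm_mult_le: "h2_norm (\<lambda>z. m z * g z) \<le> h2_norm g"
proof -
  let ?p = "\<lambda>N z. \<Sum>k<N. tcoeff k g * mz k z"
  have p: "?p N \<in> H2" for N by (intro H2_sum H2_scale mz_H2) auto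
  have c: "tcoeff n (\<lambda>z. m z * g z) = tcoeff n (?p N)" if "n < N" for n N
  proof -
    have "tcoeff n (?p N) = (\<Sum>k<N. tcoeff k g * tcoeff n (mz k))"
      by (subst tcoeff_sum) (auto simp: H2_scale mz_H2 tcoeff_scale)
    also have "\<dots> = (\<Sum>k\<in>{..n}. tcoeff k g * tcoeff (n - k) m)"
      using that by (intro sum.mono_neutral_cong_right) (auto simp: tcoeff_mz)
    also have "\<dots> = tcoeff n (\<lambda>z. g z * m z)" by (simp add: tcoeff_mult H2_holo g m_H2)
    finally show ?thesis by (simp add: mult.commute)
  qed
  \<comment> \<open>Orthonormality of the \<open>mz k\<close> makes m times a Taylor polynomial as
    long as the polynomial itself.\<close>
  have pn: "(h2_norm (?p N))\<^sup>2 = (\<Sum>k<N. (cmod (tcoeff k g))\<^sup>2)" for N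
  proof -
    have "h2_inner (\<lambda>z. tcoeff k g * mz k z) (?p N) = of_real ((cmod (tcoeff k g))\<^sup>2)" if "k < N" for k
    proof -
      have "h2_inner (\<lambda>z. tcoeff k g * mz k z) (?p N)
          = (\<Sum>j<N. if j = k then tcoeff k g * cnj (tcoeff j g) else 0)"
        unfolding inner_sum_right[OF finite_lessThan H2_scale[OF mz_H2] H2_scale[OF mz_H2]]
        by (intro sum.cong refl) (auto simp: H2_scale mz_H2 inner_scale_left inner_scale_right inner_mz_mz)
      also have "\<dots> = tcoeff k g * cnj (tcoeff k g)" using that by simp
      finally show ?thesis unfolding complex_norm_square .
    qed
    then have "h2_inner (?p N) (?p N) = of_real (\<Sum>k<N. (cmod (tcoeff k g))\<^sup>2)"
      using p[of N] by (subst inner_sum_left) (auto simp: H2_scale mz_H2)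
    then show ?thesis using inner_self[OF p[of N]] by (simp only: of_real_eq_iff)
  qed
  have "(\<Sum>n<N. (cmod (tcoeff n (\<lambda>z. m z * g z)))\<^sup>2) \<le> (h2_norm g)\<^sup>2" for N
  proof -
    have "(\<Sum>n<N. (cmod (tcoeff n (\<lambda>z. m z * g z)))\<^sup>2) = (\<Sum>n<N. (cmod (tcoeff n (?p N)))\<^sup>2)"
      by (intro sum.cong refl) (simp add: c)
    also have "\<dots> \<le> (h2_norm (?p N))\<^sup>2"
      using norm_sq_sums[OF p[of N]] sum_le_suminf[of "\<lambda>n. (cmod (tcoeff n (?p N)))\<^sup>2" "{..<N}"]
      by (simp add: sums_iff)
    also have "\<dots> \<le> (h2_norm g)\<^sup>2"
      using norm_sq_sums[OF g] sum_le_suminf[of "\<lambda>n. (cmod (tcoeff n g))\<^sup>2" "{..<N}"]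
      by (simp add: sums_iff pn)
    finally show ?thesis .
  qed
  note le = this
  then have "(\<Sum>n\<le>N. (cmod (tcoeff n (\<lambda>z. m z * g z)))\<^sup>2) \<le> (h2_norm g)\<^sup>2" for N
    unfolding lessThan_Suc_atMost[symmetric] .
  then have s: "summable (\<lambda>n. (cmod (tcoeff n (\<lambda>z. m z * g z)))\<^sup>2)"
    by (rule bounded_imp_summable[rotated]) simp
  then show mg: "(\<lambda>z. m z * g z) \<in> H2"
    using H2_holo[OF g] H2_holo[OF m_H2] outside by (auto simp: H2_def intro!: holomorphic_intros)
  have "(h2_norm (\<lambda>z. m z * g z))\<^sup>2 \<le> (h2_norm g)\<^sup>2"
    using suminf_le_const[OF s le] norm_sq_sums[OF mg] by (simp add: sums_iff)
  then show "h2_norm (\<lambda>z. m z * g z) \<le> h2_norm g" by (rule power2_le_imp_le[OF _ norm_nonneg[OF g]])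
qed

text \<open>The function m g is approximated by m times Taylor polynomials of g. Multiplication by m
  does not increase norms, so the error is at most the norm of the Taylor remainder of g.\<close>

lemma inner_mult_zero:
  assumes f: "f \<in> H2" and g: "g \<in> H2" and z: "\<And>j. h2_inner f (mz j) = 0"
  shows "h2_inner f (\<lambda>z. m z * g z) = 0"
proof -
  let ?t = "\<lambda>N z. g z - (\<Sum>k<N. tcoeff k g * disc_power k z)"
  let ?p = "\<lambda>N z. \<Sum>k<N. tcoeff k g * mz k z"
  have p: "?p N \<in> H2" for N by (intro H2_sum H2_scale mz_H2) auto
  have "cmod (h2_inner f (\<lambda>z. m z * g z)) \<le> h2_norm f * h2_norm (?t N)" for N
  proof -
    have mt: "m z * ?t N z = m z * g z - ?p N z" for z
      by (cases "cmod z < 1")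
        (simp_all add: outside right_diff_distrib sum_distrib_left disc_power_def mz_def mult_ac)
    have "h2_inner f (?p N) = 0"
      by (subst inner_sum_right) (auto simp: f H2_scale mz_H2 inner_scale_right z)
    then have "h2_inner f (\<lambda>z. m z * g z) = h2_inner f (\<lambda>z. m z * ?t N z)"
      unfolding mt by (subst inner_diff_right) (auto simp: mult_H2 g f p)
    also have "cmod \<dots> \<le> h2_norm f * h2_norm (\<lambda>z. m z * ?t N z)"
      by (intro inner_Cauchy_Schwarz f mult_H2 H2_tail g)
    also have "\<dots> \<le> h2_norm f * h2_norm (?t N)"
      by (intro mult_left_mono norm_mult_le H2_tail g norm_nonneg f)
    finally show ?thesis .
  qed
  moreover have "(\<lambda>N. h2_norm f * h2_norm (?t N)) \<longlonglongrightarrow> h2_norm f * 0"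
    by (intro tendsto_mult tendsto_const tail_norm_tendsto_0 g)
  ultimately have "cmod (h2_inner f (\<lambda>z. m z * g z)) \<le> h2_norm f * 0"
    by (intro LIMSEQ_le_const) auto
  then show ?thesis by simp
qed

lemma model_space_iff: "f \<in> model_space m \<longleftrightarrow> f \<in> H2 \<and> (\<forall>j. h2_inner f (mz j) = 0)"
proof
  assume f: "f \<in> model_space m"
  have "mz j \<in> mH2 m" for j
  proof -
    have "mz j z = m z * disc_power j z" for z
      using outside[of z] by (auto simp: mz_def disc_power_def)
    then show ?thesis unfolding mH2_def using disc_power_H2[of j] by blast
  qed
  then show "f \<in> H2 \<and> (\<forall>j. h2_inner f (mz j) = 0)" using f by (auto simp: model_space_def)
next
  assume "f \<in> H2 \<and> (\<forall>j. h2_inner f (mz j) = 0)"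
  then show "f \<in> model_space m" by (auto simp: model_space_def mH2_def inner_mult_zero)
qed

abbreviation H where "H \<equiv> model_space m"

lemma H_H2: "f \<in> H \<Longrightarrow> f \<in> H2" and H_mz: "f \<in> H \<Longrightarrow> h2_inner f (mz j) = 0"
  by (auto simp: model_space_iff)

lemma H_m_left: "f \<in> H \<Longrightarrow> h2_inner m f = 0"
  using H_mz[of f 0] inner_commute[OF m_H2 H_H2] by (simp add: mz_0)

lemma H_add: "f \<in> H \<Longrightarrow> g \<in> H \<Longrightarrow> (\<lambda>z. f z + g z) \<in> H"
  and H_diff: "f \<in> H \<Longrightarrow> g \<in> H \<Longrightarrow> (\<lambda>z. f z - g z) \<in> H"
  and H_scale: "f \<in> H \<Longrightarrow> (\<lambda>z. c * f z) \<in> H"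
  by (auto simp: model_space_iff H2_add H2_diff H2_scale inner_add_left inner_diff_left inner_scale_left mz_H2)

lemma H_bshift:
  assumes "f \<in> H" shows "bshift f \<in> H"
proof -
  have "h2_inner (bshift f) (mz j) = 0" for j
    using inner_shift_bshift[OF mz_H2 H_H2[OF assms], of j] H_mz[OF assms, of "Suc j"]
      inner_commute[OF mz_H2 H_H2[OF assms], of "Suc j"]
      inner_commute[OF H2_bshift[OF H_H2[OF assms]] mz_H2, of j] by (simp add: shift_mz)
  then show ?thesis using H2_bshift[OF H_H2[OF assms]] by (simp add: model_space_iff)
qed

text \<open>\<open>proj\<close> is a definite description, so its value is known once a candidate is
  exhibited. Two candidates differ by an element of H that is orthogonal to itself.\<close>

lemma proj_eqI:
  assumes f: "f \<in> H2" and h: "h \<in> H" and k: "\<And>k. k \<in> H \<Longrightarrow> h2_inner (\<lambda>z. f z - h z) k = 0"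
  shows "proj H f = h"
  unfolding proj_def
proof (rule the_equality)
  show "h \<in> H \<and> (\<forall>k\<in>H. h2_inner (\<lambda>z. f z - h z) k = 0)" using h k by blast
next
  fix h' assume h': "h' \<in> H \<and> (\<forall>k\<in>H. h2_inner (\<lambda>z. f z - h' z) k = 0)"
  let ?d = "\<lambda>z. h' z - h z"
  have d: "?d \<in> H" using h h' H_diff by blast
  have "h2_inner f ?d = h2_inner h ?d" "h2_inner f ?d = h2_inner h' ?d"
    using k[OF d] h' d by (auto simp: inner_diff_left f h H_H2)
  then have "h2_inner ?d ?d = 0" using h h' d by (subst inner_diff_left) (auto simp: H_H2)
  then have "?d = (\<lambda>z. 0)" by (intro inner_self_zero H_H2 d)
  then show "h' = h" by (auto simp: fun_eq_iff)
qed

text \<open>Since m is orthogonal to H, it suffices that the candidate differs from z f by a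
  multiple of m.\<close>

lemma Tm_eqI:
  assumes f: "f \<in> H" and h: "h \<in> H" and c: "\<And>z. z * f z - h z = c * m z"
  shows "Tm m f = h"
  unfolding Tm_def shift_def
  by (rule proj_eqI)
     (auto simp: H2_shift H_H2 f h c inner_scale_left m_H2 H_m_left)

text \<open>For f in H, z f is already orthogonal to z^j m with j \<ge> 1. Projecting it therefore
  removes only its component along the unit vector m, whose coefficient this is.\<close>

definition Tcoef where "Tcoef f = h2_inner (\<lambda>z. z * f z) m"

lemma Tm_expl_in_H:
  assumes f: "f \<in> H" shows "(\<lambda>z. z * f z - Tcoef f * m z) \<in> H"
proof -
  have "h2_inner (\<lambda>z. z * f z - Tcoef f * m z) (mz j) = 0" for j
  proof -
    have "h2_inner (\<lambda>z. z * f z - Tcoef f * m z) (mz j) = h2_inner (\<lambda>z. z * f z) (mz j) - Tcoef f * h2_inner (mz 0) (mz j)"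
      by (simp add: inner_diff_left inner_scale_left H2_shift H_H2 f H2_scale m_H2 mz_H2 mz_0)
    also have "\<dots> = 0"
    proof (cases j)
      case (Suc i)
      then show ?thesis using inner_shift_shift[OF H_H2[OF f] mz_H2, of i] H_mz[OF f, of i]
        by (simp add: shift_mz inner_mz_mz)
    qed (simp add: inner_m_m Tcoef_def mz_0)
    finally show ?thesis .
  qed
  moreover have "(\<lambda>z. z * f z - Tcoef f * m z) \<in> H2"
    by (intro H2_diff H2_shift H2_scale H_H2 f m_H2)
  ultimately show ?thesis by (simp add: model_space_iff)
qed

lemma Tm_expl: "f \<in> H \<Longrightarrow> Tm m f = (\<lambda>z. z * f z - Tcoef f * m z)"
  by (rule Tm_eqI[where c = "Tcoef f"]) (auto simp: Tm_expl_in_H)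

lemma Tm_H: "f \<in> H \<Longrightarrow> Tm m f \<in> H"
  by (simp add: Tm_expl Tm_expl_in_H)

lemma Tm_add:
  assumes "f \<in> H" "g \<in> H" shows "Tm m (\<lambda>z. f z + g z) = (\<lambda>z. Tm m f z + Tm m g z)"
  by (rule Tm_eqI[where c = "Tcoef f + Tcoef g"])
     (use assms in \<open>auto intro!: H_add Tm_H\<close>, auto simp: Tm_expl algebra_simps)

lemma Tm_scale:
  assumes "f \<in> H" shows "Tm m (\<lambda>z. c * f z) = (\<lambda>z. c * Tm m f z)"
  by (rule Tm_eqI[where c = "c * Tcoef f"])
     (use assms in \<open>auto intro!: H_scale Tm_H\<close>, auto simp: Tm_expl algebra_simps)

lemma inner_Tm:
  assumes "f \<in> H" "g \<in> H" shows "h2_inner (Tm m f) g = h2_inner (\<lambda>z. z * f z) g"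
  using assms by (simp add: Tm_expl inner_diff_left inner_scale_left H2_shift H_H2 H2_scale m_H2 H_m_left)

lemma inner_Tm_bshift:
  assumes "f \<in> H" "g \<in> H" shows "h2_inner (Tm m f) g = h2_inner f (bshift g)"
  using assms by (simp add: inner_Tm inner_shift_bshift H_H2)

text \<open>The squared norm of T f equals <z f, T f>. Cauchy-Schwarz and division by the norm of T
  f, if nonzero, give the bound.\<close>

lemma norm_Tm_le:
  assumes f: "f \<in> H" shows "h2_norm (Tm m f) \<le> h2_norm f"
proof -
  let ?z = "\<lambda>z. z * f z"
  have z: "?z \<in> H2" by (intro H2_shift H_H2 f)
  have n: "h2_norm ?z = h2_norm f" unfolding h2_norm_def by (simp add: inner_shift_shift H_H2 f)
  have t: "Tm m f \<in> H2" by (intro H_H2 Tm_H f)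
  have "(h2_norm (Tm m f))\<^sup>2 = cmod (h2_inner (Tm m f) (Tm m f))"
    unfolding inner_self[OF t] norm_of_real by simp
  also have "\<dots> = cmod (h2_inner ?z (Tm m f))" by (simp add: inner_Tm f Tm_H)
  also have "\<dots> \<le> h2_norm f * h2_norm (Tm m f)" using inner_Cauchy_Schwarz[OF z t] n by simp
  finally show ?thesis using norm_nonneg[OF t] norm_nonneg[OF H_H2[OF f]]
    by (cases "h2_norm (Tm m f) = 0") (auto simp: power2_eq_square)
qed

lemma adj_Tm_Tm:
  assumes g: "g \<in> H" shows "adj H (\<lambda>f. Tm m (Tm m f)) g = bshift (bshift g)"
  unfolding adj_def
proof (rule the_equality)
  let ?b = "bshift (bshift g)"
  have b: "?b \<in> H" by (intro H_bshift g)
  have e: "h2_inner (Tm m (Tm m f)) g = h2_inner f ?b" if "f \<in> H" for f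
    by (simp add: inner_Tm_bshift Tm_H H_bshift g that)
  then show "?b \<in> H \<and> (\<forall>f\<in>H. h2_inner (Tm m (Tm m f)) g = h2_inner f ?b)" using b by blast
  fix h assume h: "h \<in> H \<and> (\<forall>f\<in>H. h2_inner (Tm m (Tm m f)) g = h2_inner f h)"
  let ?d = "\<lambda>z. h z - ?b z"
  have d: "?d \<in> H" using H_diff b h by blast
  have "h2_inner ?d h = h2_inner ?d ?b" using h e d by auto
  then have "h2_inner ?d ?d = 0" using h b d by (subst inner_diff_right) (auto simp: H_H2)
  then have "?d = (\<lambda>z. 0)" by (intro inner_self_zero H_H2 d)
  then show "h = ?b" by (auto simp: fun_eq_iff)
qed

text \<open>The projection of \<open>z\<^sup>n\<close> to the model space.\<close>
definition v :: "nat \<Rightarrow> complex \<Rightarrow> complex" where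
  "v n z = disc_power n z - (\<Sum>j\<le>n. cnj (tcoeff (n - j) m) * mz j z)"

lemma v_H: "v n \<in> H"
proof -
  let ?s = "\<lambda>z. \<Sum>j\<le>n. cnj (tcoeff (n - j) m) * mz j z"
  have s: "?s \<in> H2" by (intro H2_sum H2_scale mz_H2) auto
  have v: "v n = (\<lambda>z. disc_power n z - ?s z)" by (auto simp: v_def)
  have "h2_inner (v n) (mz i) = 0" for i
  proof -
    have "h2_inner ?s (mz i) = (\<Sum>j\<le>n. if j = i then cnj (tcoeff (n - j) m) else 0)"
      unfolding inner_sum_left[OF finite_atMost H2_scale[OF mz_H2] mz_H2]
      by (intro sum.cong refl) (auto simp: mz_H2 inner_scale_left inner_mz_mz)
    \<comment> \<open>This is the pairing of z^n with z^i m; for i > n both sides are 0.\<close>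
    also have "\<dots> = cnj (tcoeff n (mz i))" by (simp add: tcoeff_mz)
    finally show ?thesis
      by (simp add: v inner_diff_left disc_power_H2 s mz_H2 inner_disc_power_left)
  qed
  then show ?thesis by (simp add: model_space_iff v H2_diff disc_power_H2 s)
qed

lemma v_Suc: "v (Suc n) z = z * v n z - cnj (tcoeff (Suc n) m) * m z"
proof -
  have "(\<Sum>j\<le>Suc n. cnj (tcoeff (Suc n - j) m) * mz j z)
      = cnj (tcoeff (Suc n) m) * m z + (\<Sum>j\<le>n. cnj (tcoeff (n - j) m) * mz (Suc j) z)"
    by (subst sum.atMost_Suc_shift) (simp add: mz_0)
  then show ?thesis
    by (simp add: v_def right_diff_distrib sum_distrib_left shift_disc_power[symmetric] shift_mz[symmetric] mult_ac)
qed

lemma Tm_v: "Tm m (v n) = v (Suc n)"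
  by (rule Tm_eqI[where c = "cnj (tcoeff (Suc n) m)"]) (auto simp: v_H v_Suc)

lemma v_0: "v 0 z = disc_power 0 z - cnj (tcoeff 0 m) * m z"
  by (simp add: v_def mz_0)

text \<open>The function z B f is f minus the constant f_0, and the constant 1 on the disc is v_0
  plus a multiple of m.\<close>

lemma Tm_bshift:
  assumes f: "f \<in> H" shows "Tm m (bshift f) = (\<lambda>z. f z - tcoeff 0 f * v 0 z)"
proof (rule Tm_eqI)
  show "bshift f \<in> H" "(\<lambda>z. f z - tcoeff 0 f * v 0 z) \<in> H"
    by (intro H_bshift H_diff H_scale v_H f)+
  show "z * bshift f z - (f z - tcoeff 0 f * v 0 z) = (- tcoeff 0 f * cnj (tcoeff 0 m)) * m z" for z
    by (simp add: shift_bshift H_H2 f v_0 algebra_simps)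
qed

lemma Tm2_bshift2:
  assumes f: "f \<in> H"
  shows "Tm m (Tm m (bshift (bshift f))) = (\<lambda>z. f z - (tcoeff 0 f * v 0 z + tcoeff 1 f * v 1 z))"
proof -
  have b: "bshift f \<in> H" by (intro H_bshift f)
  \<comment> \<open>The argument is T B^2 f, by \<open>Tm_bshift\<close> for B f, whose zeroth
    coefficient is f_1.\<close>
  have "Tm m (\<lambda>z. bshift f z + (- tcoeff 1 f) * v 0 z) = (\<lambda>z. Tm m (bshift f) z + (- tcoeff 1 f) * v 1 z)"
    using Tm_add[OF b H_scale[OF v_H[of 0], of "- tcoeff 1 f"]] Tm_scale[OF v_H[of 0], of "- tcoeff 1 f"]
    by (simp add: Tm_v)
  then show ?thesis
    by (simp add: Tm_bshift b f tcoeff_bshift H_H2 algebra_simps)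
qed

end

subsection \<open>Reducing subspaces of the square\<close>

lemma tcoeff_shift:
  "f holomorphic_on disc \<Longrightarrow> tcoeff n (\<lambda>z. z * f z) = (if n = 0 then 0 else tcoeff (n - 1) f)"
  by (cases n) (simp_all add: tcoeff_shift_0 tcoeff_shift_Suc)

lemma even_if_odd_tcoeff_0:
  assumes "f holomorphic_on disc" "\<And>n. odd n \<Longrightarrow> tcoeff n f = 0" "cmod w < 1"
  shows "f (- w) = f w"
proof -
  have "tcoeff n f * (- w) ^ n = tcoeff n f * w ^ n" for n
    using assms(2)[of n] by (cases "odd n") auto
  then have "(\<lambda>n. tcoeff n f * (- w) ^ n) sums f w" using tcoeff_sums[OF assms(1,3)] by (simp only:)
  moreover have "(\<lambda>n. tcoeff n f * (- w) ^ n) sums f (- w)" by (rule tcoeff_sums[OF assms(1)]) (simp add: assms(3))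
  ultimately show ?thesis by (rule sums_unique2[symmetric])
qed

lemma
  assumes "closed_subspace M"
  shows subspace_zero: "(\<lambda>z. 0) \<in> M"
    and subspace_add: "f \<in> M \<Longrightarrow> g \<in> M \<Longrightarrow> (\<lambda>z. f z + g z) \<in> M"
    and subspace_scale: "f \<in> M \<Longrightarrow> (\<lambda>z. c * f z) \<in> M"
  using assms unfolding closed_subspace_def by blast+

lemma subspace_limit:
  assumes "closed_subspace M" "\<And>n. x n \<in> M" "f \<in> H2" "(\<lambda>n. h2_norm (\<lambda>z. x n z - f z)) \<longlonglongrightarrow> 0"
  shows "f \<in> M"
proof -
  have "\<forall>x f. (\<forall>n. x n \<in> M) \<and> f \<in> H2 \<and> (\<lambda>n. h2_norm (\<lambda>z. x n z - f z)) \<longlonglongrightarrow> 0 \<longrightarrow> f \<in> M"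
    using assms(1) unfolding closed_subspace_def by (elim conjE)
  from this[rule_format, of x f] assms(2-4) show ?thesis by simp
qed

lemma subspace_sum:
  assumes "closed_subspace M" "finite A" "\<And>k. k \<in> A \<Longrightarrow> f k \<in> M"
  shows "(\<lambda>z. \<Sum>k\<in>A. f k z) \<in> M"
  using assms(2,3)
  by (induction A rule: finite_induct) (simp_all add: subspace_zero subspace_add assms(1))

lemma subspace_combine:
  assumes "closed_subspace M" "f \<in> M" "g \<in> M"
  shows "(\<lambda>z. a * f z + b * g z) \<in> M"
  by (rule subspace_add[OF assms(1) subspace_scale[OF assms(1,2)] subspace_scale[OF assms(1,3)]])

text \<open>With l = s y and s > 0 it is enough that 1 - s^2 |y|^2 = s, whose positive root is 2 /
  (1 + sqrt (1 + 4 |y|^2)). The parameter serves to factor z - y + cnj y * z^2.\<close>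

lemma blaschke_parameter:
  obtains l :: complex where "cmod l < 1" "y * (1 - cnj l * l) = l"
proof
  define s where "s = 2 / (1 + sqrt (1 + 4 * (cmod y)\<^sup>2))"
  define q where "q = sqrt (1 + 4 * (cmod y)\<^sup>2)"
  have q: "q \<ge> 1" "q\<^sup>2 = 1 + 4 * (cmod y)\<^sup>2" by (simp_all add: q_def)
  have s: "s = 2 / (1 + q)" by (simp add: s_def q_def)
  have "1 - s\<^sup>2 * (cmod y)\<^sup>2 = s"
  proof -
    have "(cmod y)\<^sup>2 = (q - 1) * (q + 1) / 4" using q(2) by (simp add: algebra_simps power2_eq_square)
    moreover have "(2 / (1 + q))\<^sup>2 * ((q - 1) * (q + 1) / 4) = (q - 1) / (q + 1)"
    proof -
      have "q + 1 \<noteq> 0" using q(1) by simp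
      then show ?thesis by (simp add: power2_eq_square divide_simps) (simp add: algebra_simps)
    qed
    ultimately have "s\<^sup>2 * (cmod y)\<^sup>2 = (q - 1) / (q + 1)" by (simp only: s)
    then show ?thesis using q(1) unfolding s by (simp add: field_simps)
  qed
  note e = this
  have s0: "s > 0" using q by (simp add: s)
  define l where "l = complex_of_real s * y"
  have n: "(cmod l)\<^sup>2 = s\<^sup>2 * (cmod y)\<^sup>2" by (simp add: l_def norm_mult power_mult_distrib)
  have "(cmod l)\<^sup>2 < 1\<^sup>2" using n e s0 by simp
  then show "cmod (complex_of_real s * y) < 1" unfolding l_def[symmetric] by (rule power2_less_imp_less) simp
  have "1 - cnj l * l = complex_of_real (1 - (cmod l)\<^sup>2)"
    using complex_norm_square[of l] by (simp add: mult.commute)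
  also have "\<dots> = of_real s" using n e by simp
  finally show "y * (1 - cnj (complex_of_real s * y) * (complex_of_real s * y)) = complex_of_real s * y"
    unfolding l_def[symmetric] by (simp add: l_def)
qed

context disc_inner_fun begin

lemma inner_v:
  assumes h: "h \<in> H" shows "h2_inner (v k) h = h2_inner (disc_power k) h"
proof -
  let ?s = "\<lambda>z. \<Sum>j\<le>k. cnj (tcoeff (k - j) m) * mz j z"
  have s: "?s \<in> H2" by (intro H2_sum H2_scale mz_H2) auto
  have "h2_inner (mz j) h = 0" for j
    using H_mz[OF h, of j] inner_commute[OF mz_H2 H_H2[OF h], of j] by simp
  then have "h2_inner ?s h = 0"
    unfolding inner_sum_left[OF finite_atMost H2_scale[OF mz_H2] H_H2[OF h]]
    by (intro sum.neutral) (simp add: inner_scale_left mz_H2 H_H2 h)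
  moreover have "v k = (\<lambda>z. disc_power k z - ?s z)" by (auto simp: v_def)
  ultimately show ?thesis by (simp add: inner_diff_left disc_power_H2 s H_H2 h)
qed

text \<open>Combining the v_k with Taylor coefficients of f gives the projection of a Taylor
  polynomial. As f is its own projection, the distance to f is at most that of the
  polynomial.\<close>

lemma model_space_if_v:
  assumes cl: "closed_subspace M" and sub: "M \<subseteq> H" and v: "\<And>n. v n \<in> M"
  shows "M = H"
proof
  show "H \<subseteq> M"
  proof
    fix f assume f: "f \<in> H"
    let ?x = "\<lambda>N z. \<Sum>k<N. tcoeff k f * v k z"
    let ?s = "\<lambda>N z. \<Sum>k<N. tcoeff k f * disc_power k z"
    have x: "?x N \<in> M" for N
      by (intro subspace_sum[OF cl] subspace_scale[OF cl] v) simp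
    have le: "h2_norm (\<lambda>z. ?x N z - f z) \<le> h2_norm (\<lambda>z. f z - ?s N z)" for N
    proof -
      let ?d = "\<lambda>z. ?x N z - f z" and ?t = "\<lambda>z. f z - ?s N z"
      have d: "?d \<in> H" using H_diff[OF _ f] x sub by blast
      have xH: "?x N \<in> H2" using x sub H_H2 by blast
      have sH: "?s N \<in> H2" by (intro H2_sum H2_scale disc_power_H2) auto
      have t: "?t \<in> H2" by (rule H2_tail[OF H_H2[OF f]])
      have "h2_inner (?x N) ?d = h2_inner (?s N) ?d"
        unfolding inner_sum_left[OF finite_lessThan H2_scale[OF H_H2[OF v_H]] H_H2[OF d]]
          inner_sum_left[OF finite_lessThan H2_scale[OF disc_power_H2] H_H2[OF d]]
        by (simp only: inner_scale_left[OF H_H2[OF v_H] H_H2[OF d]]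
            inner_scale_left[OF disc_power_H2 H_H2[OF d]] inner_v[OF d])
      then have "h2_inner ?d ?d = - h2_inner ?t ?d"
        using inner_diff_left[OF xH H_H2[OF f] H_H2[OF d]] inner_diff_left[OF H_H2[OF f] sH H_H2[OF d]] by simp
      then have "(h2_norm ?d)\<^sup>2 = cmod (h2_inner ?t ?d)"
        using arg_cong[OF inner_self[OF H_H2[OF d]], of cmod] unfolding norm_of_real by simp
      also have "\<dots> \<le> h2_norm ?t * h2_norm ?d" by (rule inner_Cauchy_Schwarz[OF t H_H2[OF d]])
      finally show ?thesis using norm_nonneg[OF t] norm_nonneg[OF H_H2[OF d]]
        by (cases "h2_norm ?d = 0") (auto simp: power2_eq_square)
    qed
    have "(\<lambda>N. h2_norm (\<lambda>z. ?x N z - f z)) \<longlonglongrightarrow> 0"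
    proof (rule tendsto_sandwich[OF _ _ tendsto_const tail_norm_tendsto_0[OF H_H2[OF f]]])
      show "eventually (\<lambda>N. 0 \<le> h2_norm (\<lambda>z. ?x N z - f z)) sequentially"
        using H_diff[OF _ f] x sub by (intro always_eventually allI norm_nonneg H_H2) blast
    qed (use le in auto)
    then show "f \<in> M" by (rule subspace_limit[OF cl x H_H2[OF f]])
  qed
qed (rule sub)

text \<open>Writing \<open>m = e + p\<close> for the even and odd parts, orthogonality of \<open>m\<close> and \<open>z m\<close> gives
  \<open>t \<langle>p, p\<rangle> + cnj t \<langle>p, z\<^sup>2 p\<rangle> = 0\<close> for \<open>t = w + cnj y\<close>, which makes \<open>cnj t p + t z\<^sup>2 p\<close> vanish.\<close>
lemma parity_relation_coeffs:
  assumes rel: "\<And>n. even n \<Longrightarrow> tcoeff n m = y * tcoeff (Suc n) m + w * tcoeff n (mz 1)"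
  shows "w = - cnj y"
proof -
  define a where "a n = (if odd n then tcoeff n m else 0)" for n
  have "summable (\<lambda>n. (cmod (a n))\<^sup>2)"
    by (rule summable_comparison_test[OF _ H2_summable[OF m_H2]]) (auto simp: a_def)
  then obtain p where p: "p \<in> H2" and tp: "\<And>n. tcoeff n p = a n"
    using of_coeffs_H2 tcoeff_of_coeffs by blast
  define zp where "zp = (\<lambda>z. z * p z)"
  have zp: "zp \<in> H2" unfolding zp_def by (rule H2_shift[OF p])
  have tzp: "tcoeff n zp = (if n = 0 then 0 else a (n - 1))" for n
    unfolding zp_def by (simp add: tcoeff_shift H2_holo p tp)
  define zzp where "zzp = (\<lambda>z. z * zp z)"
  have zzp: "zzp \<in> H2" unfolding zzp_def by (rule H2_shift[OF zp])
  have tzzp: "tcoeff n zzp = (if n < 2 then 0 else a (n - 2))" for n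
    unfolding zzp_def by (auto simp: tcoeff_shift H2_holo zp tzp numeral_2_eq_2)
  define bp where "bp = bshift p"
  have bp: "bp \<in> H2" unfolding bp_def by (rule H2_bshift[OF p])
  have tbp: "tcoeff n bp = a (Suc n)" for n unfolding bp_def by (simp add: tcoeff_bshift p tp)
  have zbp: "(\<lambda>z. z * bp z) = p"
    using shift_bshift[OF p] by (auto simp: bp_def tp a_def)
  \<comment> \<open>By the relation, y B p + w z p is the even part of m.\<close>
  define e where "e = (\<lambda>z. y * bp z + w * zp z)"
  have e: "e \<in> H2" unfolding e_def by (intro H2_add H2_scale bp zp)
  have te: "tcoeff n e = y * a (Suc n) + w * (if n = 0 then 0 else a (n - 1))" for n
    unfolding e_def by (simp add: tcoeff_add tcoeff_scale H2_scale bp zp tbp tzp)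
  define ze where "ze = (\<lambda>z. z * e z)"
  have ze: "ze \<in> H2" unfolding ze_def by (rule H2_shift[OF e])
  have tze: "tcoeff n ze = (if n = 0 then 0 else tcoeff (n - 1) e)" for n
    unfolding ze_def by (simp add: tcoeff_shift H2_holo e)
  have ze': "ze = (\<lambda>z. y * p z + w * zzp z)"
    unfolding ze_def e_def zzp_def using fun_cong[OF zbp] by (auto simp: algebra_simps)
  have m: "m = (\<lambda>z. e z + p z)"
  proof (rule H2_eqI[OF m_H2 H2_add[OF e p]])
    fix n
    show "tcoeff n m = tcoeff n (\<lambda>z. e z + p z)"
    proof (cases "even n")
      case True
      then show ?thesis using rel[of n] by (auto simp: tcoeff_add e p te tp a_def tcoeff_mz)
    next
      case False
      then show ?thesis by (auto simp: tcoeff_add e p te tp a_def)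
    qed
  qed
  have mz1: "mz 1 = (\<lambda>z. ze z + zp z)"
  proof
    fix z show "mz 1 z = ze z + zp z"
      using fun_cong[OF m, of z] by (simp add: mz_def ze_def zp_def distrib_left)
  qed
  define N where "N = h2_inner p p"
  define X where "X = h2_inner p zzp"
  \<comment> \<open>The pairings of e with z e and of p with z p vanish by parity, so only the two
    mixed pairings contribute.\<close>
  have "h2_inner m (mz 1) = 0" using inner_mz_mz[of 0 1] by (simp add: mz_0)
  then have "h2_inner (\<lambda>z. e z + p z) (\<lambda>z. ze z + zp z) = 0" by (simp only: mz1 m[symmetric])
  then have "h2_inner e ze + h2_inner e zp + (h2_inner p ze + h2_inner p zp) = 0"
    by (simp add: inner_add_left inner_add_right H2_add e p ze zp)
  moreover have "h2_inner e ze = 0"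
  proof -
    have o: "tcoeff n e = 0" if "odd n" for n using that by (auto simp: te a_def)
    have "tcoeff n e * cnj (tcoeff n ze) = 0" for n
    proof (cases "odd n")
      case False
      then have "tcoeff n ze = 0" using o[of "n - 1"] unfolding tze by (cases "n = 0") auto
      then show ?thesis by simp
    qed (simp add: o)
    then show ?thesis unfolding h2_inner_def by (simp only: suminf_zero)
  qed
  moreover have "h2_inner p zp = 0"
  proof -
    have "tcoeff n p * cnj (tcoeff n zp) = 0" for n by (cases "odd n") (auto simp: tp tzp a_def)
    then show ?thesis unfolding h2_inner_def by (simp only: suminf_zero)
  qed
  moreover have "h2_inner e zp = y * X + w * N"
  proof -
    have "h2_inner bp zp = X"
      using inner_shift_bshift[OF zp p] inner_commute[OF bp zp] inner_commute[OF p zzp]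
      by (simp add: bp_def[symmetric] zzp_def[symmetric] X_def)
    moreover have "h2_inner zp zp = N" unfolding zp_def N_def by (rule inner_shift_shift[OF p p])
    ultimately show ?thesis unfolding e_def by (simp add: inner_add_left inner_scale_left H2_scale bp zp)
  qed
  moreover have "h2_inner p ze = cnj y * N + cnj w * X"
    unfolding ze' N_def X_def by (simp add: inner_add_right inner_scale_right H2_scale p zzp)
  ultimately have eq: "(w + cnj y) * N + cnj (w + cnj y) * X = 0" by (simp add: algebra_simps)
  define t where "t = w + cnj y"
  have tX: "cnj t * X = - t * N" using eq unfolding t_def by (simp add: add_eq_0_iff algebra_simps)
  have "t = 0"
  proof (rule ccontr)
    assume t0: "t \<noteq> 0"
    define g where "g = (\<lambda>z. cnj t * p z + t * zzp z)"
    have g: "g \<in> H2" unfolding g_def by (intro H2_add H2_scale p zzp)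
    have N: "cnj N = N" unfolding N_def using inner_commute[OF p p] by simp
    have NN: "h2_inner zzp zzp = N"
      unfolding zzp_def N_def using inner_shift_shift[OF zp zp] inner_shift_shift[OF p p] by (simp add: zp_def)
    have "h2_inner g g = cnj t * (t * N + cnj t * X) + t * (t * cnj X + cnj t * N)"
      unfolding g_def using inner_commute[OF zzp p] NN
      by (simp add: inner_add_left inner_add_right inner_scale_left inner_scale_right H2_add H2_scale p zzp
          N_def X_def algebra_simps)
    moreover have "t * cnj X = - cnj t * N" using arg_cong[OF tX, of cnj] N by simp
    ultimately have "h2_inner g g = 0" using tX by simp
    then have "g = (\<lambda>z. 0)" by (rule inner_self_zero[OF g])
    then have "tcoeff n g = 0" for n by (simp add: tcoeff_zero)
    \<comment> \<open>This recursion in steps of two, with zero in place of the terms before index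
      0, forces p and hence m to vanish, although m has norm 1.\<close>
    then have r: "cnj t * a n + t * (if n < 2 then 0 else a (n - 2)) = 0" for n
      unfolding g_def by (simp add: tcoeff_add tcoeff_scale H2_scale p zzp tp tzzp)
    have a0: "a n = 0" for n
    proof (induction n rule: less_induct)
      case (less n)
      show ?case using r[of n] less[of "n - 2"] t0 by (auto split: if_splits)
    qed
    have "m = (\<lambda>z. 0)"
    proof (rule H2_eqI[OF m_H2 H2_zero])
      fix n show "tcoeff n m = tcoeff n (\<lambda>z. 0)"
        using arg_cong[OF m, of "tcoeff n"] by (simp add: tcoeff_add e p te tp a0 tcoeff_zero)
    qed
    then show False using inner_m_m inner_zero_left[of m] by simp
  qed
  then show ?thesis by (simp add: t_def add_eq_0_iff)
qed

text \<open>The relation makes (z - y - w z^2) m even. Up to a constant the quadratic is (z - l)(1 +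
  cnj l * z), so m divided by the Blaschke factor of -l equals its own reflection. The points w0 and
  -w0 are left out of B because one of the two denominators vanishes there, and division by 0 yields
  0.\<close>

lemma no_parity_relation:
  assumes B: "\<And>w0. w0 \<in> disc \<Longrightarrow> m w0 = 0 \<Longrightarrow>
      \<exists>w\<in>disc - {w0, - w0}. m w / ((w - w0) / (1 - cnj w0 * w)) \<noteq> m (- w) / ((- w - w0) / (1 - cnj w0 * (- w)))"
    and rel: "\<And>n. even n \<Longrightarrow> tcoeff n m = y * tcoeff (Suc n) m + w * tcoeff n (mz 1)"
  shows False
proof -
  have w: "w = - cnj y" by (rule parity_relation_coeffs[OF rel])
  define F where "F = (\<lambda>z. mz 1 z - y * m z - w * mz 2 z)"
  have F: "F \<in> H2" unfolding F_def by (intro H2_diff H2_scale mz_H2 m_H2)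
  have tF: "tcoeff n F = tcoeff n (mz 1) - y * tcoeff n m - w * tcoeff n (mz 2)" for n
    unfolding F_def by (simp add: tcoeff_diff tcoeff_scale H2_diff H2_scale mz_H2 m_H2)
  have "tcoeff n F = 0" if n: "odd n" for n
  proof -
    obtain k where k: "n = Suc k" using n by (cases n) auto
    have "tcoeff k m = y * tcoeff (Suc k) m + w * tcoeff k (mz 1)" using n k by (intro rel) simp
    then show ?thesis by (cases k) (simp_all add: tF tcoeff_mz k)
  qed
  then have ev: "F (- z) = F z" if "cmod z < 1" for z
    by (rule even_if_odd_tcoeff_0[OF H2_holo[OF F] _ that])
  have F': "F z = (z - y + cnj y * z\<^sup>2) * m z" for z
    unfolding F_def w mz_def by (simp add: algebra_simps power2_eq_square)
  obtain l where l: "cmod l < 1" "y * (1 - cnj l * l) = l" by (rule blaschke_parameter)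
  define c where "c = 1 - cnj l * l"
  have cr: "cnj c = c" by (simp add: c_def mult.commute)
  have yc1: "y * c = l" using l(2) by (simp add: c_def)
  have yc2: "cnj y * c = cnj l" using arg_cong[OF yc1, of cnj] unfolding complex_cnj_mult cr .
  note yc = yc1 yc2
  have fac: "c * F z = (z - l) * (1 + cnj l * z) * m z" for z
  proof -
    have "c * F z = (c * z - y * c + cnj y * c * z\<^sup>2) * m z" unfolding F' by (simp add: algebra_simps)
    also have "\<dots> = (z - l) * (1 + cnj l * z) * m z" unfolding yc by (simp add: c_def algebra_simps power2_eq_square)
    finally show ?thesis .
  qed
  have key: "(z - l) * (1 + cnj l * z) * m z = - ((z + l) * (1 - cnj l * z) * m (- z))" if "cmod z < 1" for z
  proof -
    have "(z - l) * (1 + cnj l * z) * m z = (- z - l) * (1 + cnj l * (- z)) * m (- z)"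
      using fac[of z] fac[of "- z"] ev[OF that] by simp
    then show ?thesis by (simp add: algebra_simps)
  qed
  have c0: "c \<noteq> 0"
  proof
    assume "c = 0"
    then have "complex_of_real ((cmod l)\<^sup>2) = 1" using complex_norm_square[of l] by (simp add: c_def mult.commute)
    then have "(cmod l)\<^sup>2 = 1" by (simp only: of_real_eq_1_iff)
    then show False using l(1) norm_ge_zero[of l] by (auto simp: power2_eq_1_iff simp del: norm_ge_zero)
  qed
  \<comment> \<open>At z = l the identity \<open>key\<close> leaves 2 l (1 - |l|^2) m(-l) = 0. For l
    = 0 it says nothing, but then y = w = 0 and the relation at index 0 gives m(0) = 0.\<close>
  have "m (- l) = 0"
  proof (cases "l = 0")
    case True
    then have "y = 0" "w = 0" using yc c0 w by auto
    then show ?thesis using True rel[of 0] tcoeff_sums[OF H2_holo[OF m_H2], of 0] by (simp add: tcoeff_def)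
  next
    case False
    then show ?thesis using key[OF l(1)] c0 by (auto simp: c_def)
  qed
  then have "\<exists>w\<in>disc - {- l, - (- l)}. m w / ((w - - l) / (1 - cnj (- l) * w)) \<noteq>
      m (- w) / ((- w - - l) / (1 - cnj (- l) * (- w)))"
    using l(1) by (intro B) simp_all
  then obtain z where z: "z \<in> disc - {- l, - (- l)}"
    and ne: "m z / ((z - - l) / (1 - cnj (- l) * z)) \<noteq> m (- z) / ((- z - - l) / (1 - cnj (- l) * (- z)))"
    by blast
  have z1: "cmod z < 1" using z by simp
  have zl: "z + l \<noteq> 0" "- z + l \<noteq> 0" using z by (auto simp: add_eq_0_iff2)
  have "m z * (1 + cnj l * z) * (- z + l) = m (- z) * (1 - cnj l * z) * (z + l)"
    using key[OF z1] by (simp add: algebra_simps)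
  then have "m z * (1 + cnj l * z) / (z + l) = m (- z) * (1 - cnj l * z) / (- z + l)"
    by (simp only: frac_eq_eq[OF zl])
  then show False using ne by simp
qed

end

section \<open>Coefficient relations forced by a one-dimensional space of initial pairs\<close>

context disc_inner_fun begin

lemma tcoeff_v_0: "tcoeff n (v 0) = (if n = 0 then 1 else 0) - cnj (tcoeff 0 m) * tcoeff n m"
proof -
  have "v 0 = (\<lambda>z. disc_power 0 z - cnj (tcoeff 0 m) * m z)" by (auto simp: v_0)
  then show ?thesis by (simp add: tcoeff_diff tcoeff_scale H2_scale m_H2 disc_power_H2 tcoeff_disc_power)
qed

lemma tcoeff_v_Suc:
  "tcoeff n (v (Suc k)) = (if n = 0 then 0 else tcoeff (n - 1) (v k)) - cnj (tcoeff (Suc k) m) * tcoeff n m"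
proof -
  have "v (Suc k) = (\<lambda>z. z * v k z - cnj (tcoeff (Suc k) m) * m z)" by (auto simp: v_Suc)
  moreover have "(\<lambda>z. z * v k z) \<in> H2" by (intro H2_shift H_H2 v_H)
  ultimately show ?thesis
    by (simp add: tcoeff_diff tcoeff_scale H2_scale m_H2 tcoeff_shift H2_holo H_H2 v_H)
qed

text \<open>The relation between even and odd coefficients is preserved by multiplication by \<open>z\<^sup>2\<close>, so it holds for
  \<open>u\<^sub>k - z\<^sup>2 u\<^sub>k\<^sub>-\<^sub>1 = - (\<beta>\<^sub>k + \<alpha>\<^sub>k z) m\<close>.\<close>
lemma parity_relation_of_shape:
  fixes a b :: complex
  defines "u k n \<equiv> a * tcoeff n (v (2 * k)) + b * tcoeff n (v (Suc (2 * k)))"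
  assumes shape: "\<And>k n. a * u k (Suc (2 * n)) = b * u k (2 * n)"
  defines "\<beta> k \<equiv> a * cnj (tcoeff (2 * k) m) + b * cnj (tcoeff (Suc (2 * k)) m)"
  defines "\<alpha> k \<equiv> a * cnj (tcoeff (2 * k) (mz 1)) + b * cnj (tcoeff (2 * k) m)"
  shows "a * (\<beta> k * tcoeff (Suc (2 * n)) m + \<alpha> k * tcoeff (2 * n) m)
       = b * (\<beta> k * tcoeff (2 * n) m + \<alpha> k * tcoeff (2 * n) (mz 1))"
proof (cases k)
  \<comment> \<open>There is no predecessor here: \<open>u 0\<close> belongs to a + b z -
    (\<open>\<beta> 0\<close> + \<open>\<alpha> 0\<close> z) m, and a + b z satisfies the
    relation.\<close>
  case 0
  show ?thesis
  proof (cases n)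
    case 0
    then show ?thesis using shape[of k n] \<open>k = 0\<close>
      by (simp add: u_def \<alpha>_def \<beta>_def tcoeff_v_0 tcoeff_v_Suc tcoeff_mz) (simp add: algebra_simps)
  next
    case (Suc i)
    then show ?thesis using shape[of k n] \<open>k = 0\<close>
      by (simp add: u_def \<alpha>_def \<beta>_def tcoeff_v_0 tcoeff_v_Suc tcoeff_mz) (simp add: algebra_simps)
  qed
next
  case (Suc j)
  show ?thesis
  proof (cases n)
    case 0
    then show ?thesis using shape[of k n] \<open>k = Suc j\<close>
      by (simp add: u_def \<alpha>_def \<beta>_def tcoeff_v_Suc tcoeff_mz) (simp add: algebra_simps)
  next
    case (Suc i)
    \<comment> \<open>Subtracting the instance for j and i removes the contribution of z^2
      u_j.\<close>
    then show ?thesis using shape[of k n] shape[of j i] \<open>k = Suc j\<close>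
      by (simp add: u_def \<alpha>_def \<beta>_def tcoeff_v_Suc[of _ "Suc _"] tcoeff_v_Suc[of "Suc (Suc _)"]
         tcoeff_v_Suc[of "Suc _" "2 * j"] tcoeff_mz) (simp add: algebra_simps)
  qed
qed

text \<open>The relation reads \<open>\<delta> k\<close> m_(2n) = a \<open>\<beta> k\<close>
  m_(2n+1) - b \<open>\<alpha> k\<close> m_(2n-1), with m_(-1) = 0. A nonzero
  \<open>\<delta> k\<close> can be divided out and leads to \<open>no_parity_relation\<close>. If
  all of them vanish, b^2 and a^2 link consecutive odd coefficients so that all of these are 0,
  against A.\<close>

lemma shape_impossible:
  assumes B: "\<And>w0. w0 \<in> disc \<Longrightarrow> m w0 = 0 \<Longrightarrow>
      \<exists>w\<in>disc - {w0, - w0}. m w / ((w - w0) / (1 - cnj w0 * w)) \<noteq> m (- w) / ((- w - w0) / (1 - cnj w0 * (- w)))"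
    and A: "\<exists>w\<in>disc. m w \<noteq> m (- w)"
    and ab: "a \<noteq> 0 \<or> b \<noteq> 0"
    and shape: "\<And>k n. a * (a * tcoeff (Suc (2 * n)) (v (2 * k)) + b * tcoeff (Suc (2 * n)) (v (Suc (2 * k))))
        = b * (a * tcoeff (2 * n) (v (2 * k)) + b * tcoeff (2 * n) (v (Suc (2 * k))))"
  shows False
proof -
  define \<beta> where "\<beta> k = a * cnj (tcoeff (2 * k) m) + b * cnj (tcoeff (Suc (2 * k)) m)" for k
  define \<alpha> where "\<alpha> k = a * cnj (tcoeff (2 * k) (mz 1)) + b * cnj (tcoeff (2 * k) m)" for k
  define \<delta> where "\<delta> k = b * \<beta> k - a * \<alpha> k" for k
  have r: "a * (\<beta> k * tcoeff (Suc (2 * n)) m + \<alpha> k * tcoeff (2 * n) m)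
       = b * (\<beta> k * tcoeff (2 * n) m + \<alpha> k * tcoeff (2 * n) (mz 1))" for k n
    unfolding \<alpha>_def \<beta>_def by (rule parity_relation_of_shape[OF shape])
  show False
  proof (cases "\<exists>k. \<delta> k \<noteq> 0")
    case True
    then obtain k where k: "\<delta> k \<noteq> 0" ..
    have rel: "tcoeff i m = (a * \<beta> k / \<delta> k) * tcoeff (Suc i) m + (- b * \<alpha> k / \<delta> k) * tcoeff i (mz 1)"
      if "even i" for i
    proof -
      obtain n where n: "i = 2 * n" using \<open>even i\<close> by blast
      have "\<delta> k * tcoeff (2 * n) m = a * \<beta> k * tcoeff (Suc (2 * n)) m - b * \<alpha> k * tcoeff (2 * n) (mz 1)"
        using r[of k n] by (simp add: \<delta>_def algebra_simps)
      then have "tcoeff (2 * n) m = (a * \<beta> k * tcoeff (Suc (2 * n)) m - b * \<alpha> k * tcoeff (2 * n) (mz 1)) / \<delta> k"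
        using k by (simp add: nonzero_eq_divide_eq mult.commute)
      then show ?thesis by (simp add: n diff_divide_distrib)
    qed
    show False by (rule no_parity_relation[OF _ rel]) (intro B)
  next
    case False
    then have z: "b\<^sup>2 * cnj (tcoeff (Suc (2 * k)) m) = a\<^sup>2 * cnj (tcoeff (2 * k) (mz 1))" for k
      by (simp add: \<delta>_def \<alpha>_def \<beta>_def algebra_simps power2_eq_square)
    have o: "tcoeff (Suc (2 * k)) m = 0" for k
    \<comment> \<open>For b = 0, a is nonzero and the identity at k + 1 gives the claim. Otherwise
      the odd coefficients vanish by induction, started by the zero constant term of z m.\<close>
    proof (cases "b = 0")
      case True
      then show ?thesis using z[of "Suc k"] ab by (simp add: tcoeff_mz)
    next
      case False
      show ?thesis
      proof (induction k)
        case 0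
        then show ?case using z[of 0] False by (simp add: tcoeff_mz)
      next
        case (Suc k)
        then show ?case using z[of "Suc k"] False by (simp add: tcoeff_mz)
      qed
    qed
    have "m (- w) = m w" if "cmod w < 1" for w
    proof (rule even_if_odd_tcoeff_0[OF H2_holo[OF m_H2] _ that])
      fix n :: nat assume "odd n"
      then obtain k where "n = Suc (2 * k)" by (auto elim: oddE)
      then show "tcoeff n m = 0" using o by simp
    qed
    then show False using A by force
  qed
qed

lemma irreducible_Tm2:
  assumes B: "\<And>w0. w0 \<in> disc \<Longrightarrow> m w0 = 0 \<Longrightarrow>
      \<exists>w\<in>disc - {w0, - w0}. m w / ((w - w0) / (1 - cnj w0 * w)) \<noteq> m (- w) / ((- w - w0) / (1 - cnj w0 * (- w)))"
    and A: "\<exists>w\<in>disc. m w \<noteq> m (- w)"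
  shows "irreducible_op H (\<lambda>f. Tm m (Tm m f))"
  unfolding irreducible_op_def
proof (intro allI impI)
  fix M assume "closed_subspace M \<and> M \<subseteq> H \<and> invariant (\<lambda>f. Tm m (Tm m f)) M \<and>
      invariant (adj H (\<lambda>f. Tm m (Tm m f))) M"
  then have cl: "closed_subspace M" and sub: "M \<subseteq> H" and inv: "\<And>f. f \<in> M \<Longrightarrow> Tm m (Tm m f) \<in> M"
    and "invariant (adj H (\<lambda>f. Tm m (Tm m f))) M" by (auto simp: invariant_def)
  then have binv: "bshift (bshift f) \<in> M" if "f \<in> M" for f
    using that adj_Tm_Tm by (force simp: invariant_def)
  \<comment> \<open>This is f - T^2 B^2 f, a difference of two elements of M.\<close>
  have start: "(\<lambda>z. tcoeff 0 f * v 0 z + tcoeff 1 f * v 1 z) \<in> M" if f: "f \<in> M" for f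
    using subspace_combine[OF cl f inv[OF binv[OF f]], of 1 "-1"] Tm2_bshift2[of f] f sub by (auto simp: algebra_simps)
  \<comment> \<open>B^2 lowers indices by two, so a property of the initial pairs on M passes to all
    pairs (f_(2n), f_(2n+1)).\<close>
  have shift2: "P (tcoeff (2 * n) f) (tcoeff (Suc (2 * n)) f)"
    if P: "\<And>f. f \<in> M \<Longrightarrow> P (tcoeff 0 f) (tcoeff 1 f)" and f: "f \<in> M" for P n f
    using f
  proof (induction n arbitrary: f)
    case 0
    then show ?case using P[of f] by simp
  next
    case (Suc n)
    have "f \<in> H2" using Suc.prems sub H_H2 by blast
    then show ?case using Suc.IH[OF binv[OF Suc.prems]] by (simp add: tcoeff_bshift H2_bshift)
  qed
  show "M = {\<lambda>z. 0} \<or> M = H"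
  proof (cases "\<forall>f\<in>M. tcoeff 0 f = 0 \<and> tcoeff 1 f = 0")
    case True
    have "f = (\<lambda>z. 0)" if f: "f \<in> M" for f
    proof (rule H2_eqI[OF _ H2_zero])
      show "f \<in> H2" using f sub H_H2 by blast
      fix n
      have "tcoeff (2 * k) f = 0 \<and> tcoeff (Suc (2 * k)) f = 0" for k
        by (rule shift2[where P = "\<lambda>x y. x = 0 \<and> y = 0", OF _ f]) (use True in auto)
      then show "tcoeff n f = tcoeff n (\<lambda>z. 0)"
        by (cases "even n") (auto simp: tcoeff_zero elim!: evenE oddE)
    qed
    then show ?thesis using subspace_zero[OF cl] by blast
  next
    case False
    then obtain f where f: "f \<in> M" and f0: "tcoeff 0 f \<noteq> 0 \<or> tcoeff 1 f \<noteq> 0" by blast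
    define a where "a = tcoeff 0 f"
    define b where "b = tcoeff 1 f"
    have u0: "(\<lambda>z. a * v 0 z + b * v 1 z) \<in> M" using start[OF f] by (simp add: a_def b_def)
    show ?thesis
    \<comment> \<open>Here all initial pairs are proportional to (a, b), or else two of them are
      independent.\<close>
    proof (cases "\<forall>g\<in>M. a * tcoeff 1 g = b * tcoeff 0 g")
      case True
      have u: "(\<lambda>z. a * v (2 * k) z + b * v (Suc (2 * k)) z) \<in> M" for k
      proof (induction k)
        case 0
        then show ?case using u0 by simp
      next
        case (Suc k)
        have "Tm m (Tm m (\<lambda>z. a * v i z + b * v j z)) = (\<lambda>z. a * v (Suc (Suc i)) z + b * v (Suc (Suc j)) z)" for i j
          by (simp add: Tm_add Tm_scale H_scale v_H Tm_v)
        then show ?case using inv[OF Suc] by simp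
      qed
      have "a * tcoeff (Suc (2 * n)) g = b * tcoeff (2 * n) g" if "g \<in> M" for g n
        by (rule shift2[where P = "\<lambda>x y. a * y = b * x", OF _ that]) (use True in auto)
      from this[OF u] have False
        by (intro shape_impossible[OF B A, of a b])
           (use f0 in \<open>auto simp: a_def b_def tcoeff_add tcoeff_scale H2_scale H_H2 v_H\<close>)
      then show ?thesis ..
    next
      case False
      then obtain g where g: "g \<in> M" and ne: "a * tcoeff 1 g \<noteq> b * tcoeff 0 g" by blast
      define c where "c = tcoeff 0 g"
      define d where "d = tcoeff 1 g"
      have u1: "(\<lambda>z. c * v 0 z + d * v 1 z) \<in> M" using start[OF g] by (simp add: c_def d_def)
      \<comment> \<open>Cramer's rule with this determinant recovers v_0 and v_1 from two elements
        of M; T^2 then produces every v_n.\<close>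
      define D where "D = a * d - b * c"
      have D: "D \<noteq> 0" using ne by (simp add: D_def c_def d_def)
      have "v 0 = (\<lambda>z. (d / D) * (a * v 0 z + b * v 1 z) + (- b / D) * (c * v 0 z + d * v 1 z))"
      proof
        fix z
        have "(d / D) * (a * v 0 z + b * v 1 z) + (- b / D) * (c * v 0 z + d * v 1 z) = (D * v 0 z) / D"
          by (simp add: D_def diff_divide_distrib add_divide_distrib algebra_simps)
        then show "v 0 z = (d / D) * (a * v 0 z + b * v 1 z) + (- b / D) * (c * v 0 z + d * v 1 z)"
          using D by simp
      qed
      then have v0: "v 0 \<in> M" using subspace_combine[OF cl u0 u1] by metis
      have "v 1 = (\<lambda>z. (- c / D) * (a * v 0 z + b * v 1 z) + (a / D) * (c * v 0 z + d * v 1 z))"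
      proof
        fix z
        have "(- c / D) * (a * v 0 z + b * v 1 z) + (a / D) * (c * v 0 z + d * v 1 z) = (D * v 1 z) / D"
          by (simp add: D_def diff_divide_distrib add_divide_distrib algebra_simps)
        then show "v 1 z = (- c / D) * (a * v 0 z + b * v 1 z) + (a / D) * (c * v 0 z + d * v 1 z)"
          using D by simp
      qed
      then have v1: "v 1 \<in> M" using subspace_combine[OF cl u0 u1] by metis
      have "v n \<in> M \<and> v (Suc n) \<in> M" for n
      proof (induction n)
        case (Suc n)
        then show ?case using inv[of "v n"] by (simp add: Tm_v)
      qed (use v0 v1 in auto)
      then show ?thesis using model_space_if_v[OF cl sub] by blast
    qed
  qed
qed

end

subsection \<open>A non-hyperinvariant subspace\<close>

text \<open>The function f(-z) has coefficients (-1)^n f_n, and coefficients are unique.\<close>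

lemma odd_tcoeff_0_if_even:
  assumes f: "f holomorphic_on disc" and ev: "\<And>w. cmod w < 1 \<Longrightarrow> f w = f (- w)" and n: "odd n"
  shows "tcoeff n f = 0"
proof -
  have "(\<lambda>k. (tcoeff k f * (- 1) ^ k) * z ^ k) sums f z" if "cmod z < 1" for z
  proof -
    have "(\<lambda>k. tcoeff k f * (- z) ^ k) sums f (- z)" by (rule tcoeff_sums[OF f]) (simp add: that)
    moreover have "tcoeff k f * (- z) ^ k = (tcoeff k f * (- 1) ^ k) * z ^ k" for k
      by (simp only: power_minus[of z] mult.assoc)
    ultimately show ?thesis by (simp only: ev[OF that])
  qed
  from tcoeff_unique[of "\<lambda>k. tcoeff k f * (- 1) ^ k", OF this]
  have "tcoeff n f = tcoeff n f * (- 1) ^ n" .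
  with n show ?thesis by simp
qed

lemma inner_limit_zero:
  assumes x: "\<And>n. x n \<in> H2" and f: "f \<in> H2" and g: "g \<in> H2"
    and z: "\<And>n. h2_inner (x n) g = 0" and lim: "(\<lambda>n. h2_norm (\<lambda>z. x n z - f z)) \<longlonglongrightarrow> 0"
  shows "h2_inner f g = 0"
proof -
  have "cmod (h2_inner f g) \<le> h2_norm (\<lambda>z. x n z - f z) * h2_norm g" for n
    using inner_Cauchy_Schwarz[OF H2_diff[OF x f] g, of n] inner_diff_left[OF x f g, of n] z[of n] by simp
  moreover have "(\<lambda>n. h2_norm (\<lambda>z. x n z - f z) * h2_norm g) \<longlonglongrightarrow> 0 * h2_norm g"
    by (intro tendsto_mult lim tendsto_const)
  ultimately have "cmod (h2_inner f g) \<le> 0 * h2_norm g"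
    by (intro LIMSEQ_le_const) auto
  then show ?thesis by simp
qed

lemma closed_subspace_orthogonal:
  assumes "G \<subseteq> H2"
  shows "closed_subspace {f \<in> H2. \<forall>g\<in>G. h2_inner f g = 0}"
proof -
  have G: "g \<in> H2" if "g \<in> G" for g using assms that by blast
  show ?thesis
    unfolding closed_subspace_def
  proof (intro conjI ballI allI impI)
    fix x f
    assume a: "(\<forall>n. x n \<in> {f \<in> H2. \<forall>g\<in>G. h2_inner f g = 0}) \<and> f \<in> H2 \<and>
      (\<lambda>n. h2_norm (\<lambda>z. x n z - f z)) \<longlonglongrightarrow> 0"
    have "h2_inner f g = 0" if "g \<in> G" for g
      by (rule inner_limit_zero[of x]) (use a G[OF that] that in auto)
    then show "f \<in> {f \<in> H2. \<forall>g\<in>G. h2_inner f g = 0}" using a by simp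
  qed (auto simp: H2_zero H2_add H2_scale inner_zero_left inner_add_left inner_scale_left G)
qed

context disc_inner_fun begin

lemma bounded_op_Tm: "bounded_op H (Tm m)"
  unfolding bounded_op_def
proof (intro conjI ballI allI exI[of _ 1])
  show "h2_norm (Tm m f) \<le> 1 * h2_norm f" if "f \<in> H" for f using norm_Tm_le[OF that] by simp
qed (simp_all add: Tm_H Tm_add Tm_scale)

lemma Lat_Tm2_neq_HypLat:
  assumes p: "disc_inner_fun p" and q: "disc_inner_fun q" and mpq: "\<And>z. m z = p z * q z"
    and even: "\<And>w. cmod w < 1 \<Longrightarrow> p w = p (- w)" and nonconst: "\<not> (\<exists>c. \<forall>w\<in>disc. p w = c)"
  shows "Lat H (\<lambda>f. Tm m (Tm m f)) \<noteq> HypLat H (\<lambda>f. Tm m (Tm m f))"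
proof -
  interpret P: disc_inner_fun p by (rule p)
  interpret Q: disc_inner_fun q by (rule q)
  \<comment> \<open>Since m g = p (q g) with q g in \<open>H2\<close>, \<open>mH2 m\<close> lies in
    \<open>mH2 p\<close>, and orthogonal complements reverse the inclusion.\<close>
  have sub: "f \<in> H" if f: "f \<in> P.H" for f
  proof -
    have "h2_inner f (\<lambda>z. m z * g z) = 0" if g: "g \<in> H2" for g
    proof -
      have "(\<lambda>z. m z * g z) = (\<lambda>z. p z * (q z * g z))" by (simp add: mpq mult.assoc)
      then have "(\<lambda>z. m z * g z) \<in> mH2 p" using Q.mult_H2[OF g] unfolding mH2_def
        by (intro CollectI exI[of _ "\<lambda>z. q z * g z"]) simp
      then show ?thesis using f by (simp add: model_space_def)
    qed
    then show ?thesis using P.H_H2[OF f] by (auto simp: model_space_def mH2_def)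
  qed
  have podd: "tcoeff n p = 0" if "odd n" for n
    by (rule odd_tcoeff_0_if_even[OF H2_holo[OF P.m_H2] even that])
  define N where "N = {g \<in> P.H. \<forall>n. Parity.even n \<longrightarrow> tcoeff n g = 0}"
  \<comment> \<open>The complement of N in H, written as one annihilator so that
    \<open>closed_subspace_orthogonal\<close> applies.\<close>
  define M where "M = {f \<in> H2. \<forall>g\<in>mH2 m \<union> N. h2_inner f g = 0}"
  have NH: "g \<in> H" if "g \<in> N" for g using that sub by (simp add: N_def)
  have MH: "f \<in> M \<longleftrightarrow> f \<in> H \<and> (\<forall>g\<in>N. h2_inner f g = 0)" for f
    by (auto simp: M_def model_space_def)
  have "mH2 m \<union> N \<subseteq> H2" using NH H_H2 mult_H2 by (auto simp: mH2_def)
  then have cl: "closed_subspace M" unfolding M_def by (rule closed_subspace_orthogonal)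
  \<comment> \<open>Invariance of N under the adjoint B^2 gives invariance of M under T^2.\<close>
  have NB: "bshift (bshift g) \<in> N" if "g \<in> N" for g
    using that by (auto simp: N_def P.H_bshift tcoeff_bshift H2_bshift P.H_H2)
  have "Tm m (Tm m f) \<in> M" if f: "f \<in> M" for f
  proof -
    have fH: "f \<in> H" using f MH by blast
    have "h2_inner (Tm m (Tm m f)) g = 0" if g: "g \<in> N" for g
    proof -
      have "h2_inner (Tm m (Tm m f)) g = h2_inner f (bshift (bshift g))"
        by (simp add: inner_Tm_bshift Tm_H H_bshift NH[OF g] fH)
      then show ?thesis using f MH NB[OF g] by simp
    qed
    then show ?thesis using MH Tm_H fH by blast
  qed
  then have inLat: "M \<in> Lat H (\<lambda>f. Tm m (Tm m f))"
    using cl MH by (auto simp: Lat_def invariant_def)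
  have "M \<notin> HypLat H (\<lambda>f. Tm m (Tm m f))"
  proof
    assume "M \<in> HypLat H (\<lambda>f. Tm m (Tm m f))"
    \<comment> \<open>T is bounded and commutes with T^2, so hyperinvariance would include
      invariance under T.\<close>
    then have inv: "invariant (Tm m) M" using bounded_op_Tm by (auto simp: HypLat_def)
    let ?h = "P.v 0" and ?g = "\<lambda>z. z * P.v 0 z"
    have h: "?h \<in> H2" by (intro P.H_H2 P.v_H)
    have g: "?g \<in> H2" by (rule H2_shift[OF h])
    have hodd: "tcoeff n ?h = 0" if "odd n" for n using podd[OF that] odd_pos[OF that] by (simp add: P.tcoeff_v_0)
    have geven: "tcoeff n ?g = 0" if "Parity.even n" for n
      using that hodd[of "n - 1"] unfolding tcoeff_shift[OF H2_holo[OF h]] by (cases "n = 0") auto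
    \<comment> \<open>For j = 0 an odd function meets the even p; for j > 0 the isometry of the
      shift reduces to h being orthogonal to z^(j-1) p.\<close>
    have "h2_inner ?g (P.mz j) = 0" for j
    proof (cases j)
      case 0
      have "tcoeff n ?g * cnj (tcoeff n p) = 0" for n
        using geven[of n] podd[of n] by (cases "odd n") simp_all
      then show ?thesis unfolding 0 P.mz_0 h2_inner_def by (simp only: suminf_zero)
    next
      case (Suc i)
      then show ?thesis using inner_shift_shift[OF h P.mz_H2, of i] P.H_mz[OF P.v_H, of 0 i]
        by (simp add: P.shift_mz)
    qed
    then have "?g \<in> P.H" using g by (simp add: P.model_space_iff)
    then have gN: "?g \<in> N" using geven by (simp add: N_def)
    have "h2_inner ?h k = 0" if "k \<in> N" for k
    proof -
      have "tcoeff n ?h * cnj (tcoeff n k) = 0" for n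
        using that hodd[of n] by (cases "odd n") (auto simp: N_def)
      then show ?thesis unfolding h2_inner_def by (simp only: suminf_zero)
    qed
    then have hM: "?h \<in> M" using sub[OF P.v_H] MH by blast
    then have "Tm m ?h \<in> M" using inv by (simp add: invariant_def)
    then have "h2_inner (Tm m ?h) ?g = 0" using gN MH by blast
    then have "h2_inner ?h ?h = 0"
      using inner_Tm[OF sub[OF P.v_H] NH[OF gN]] inner_shift_shift[OF h h] by simp
    then have h0: "?h = (\<lambda>z. 0)" by (rule inner_self_zero[OF h])
    \<comment> \<open>If h = 0, then 1 = cnj p_0 * p on the disc, which makes p constant.\<close>
    have "p w = 1 / cnj (tcoeff 0 p)" if "w \<in> disc" for w
    proof -
      have "1 - cnj (tcoeff 0 p) * p w = 0" using fun_cong[OF h0, of w] P.v_0[of w] that by (simp add: disc_power_def)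
      then have "cnj (tcoeff 0 p) * p w = 1" by simp
      moreover then have "cnj (tcoeff 0 p) \<noteq> 0" by fastforce
      ultimately show ?thesis by (simp add: nonzero_eq_divide_eq mult.commute)
    qed
    then show False using nonconst by blast
  qed
  then show ?thesis using inLat by blast
qed

end

section \<open>Reduction to inner functions vanishing off the disc, and the final theorem\<close>

definition cutoff :: "(complex \<Rightarrow> complex) \<Rightarrow> complex \<Rightarrow> complex" where
  "cutoff f z = (if cmod z < 1 then f z else 0)"

lemma radial_in_disc: "eventually (\<lambda>r. cmod (complex_of_real r * cis t) < 1) (at_left 1)"
proof -
  have "eventually (\<lambda>r::real. r \<in> {0<..<1}) (at_left 1)" by (rule eventually_at_leftI[of 0]) auto
  then show ?thesis by eventually_elim (auto simp: norm_mult)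
qed

lemma cutoff_disc_inner_fun:
  assumes "inner_fun f" shows "disc_inner_fun (cutoff f)"
proof
  have f: "f holomorphic_on disc" "bounded (f ` disc)" using assms by (auto simp: inner_fun_def Hinf_def)
  have "cutoff f holomorphic_on disc"
    by (rule holomorphic_transform[OF f(1)]) (simp add: cutoff_def)
  moreover have "cutoff f ` disc = f ` disc" by (rule image_cong) (auto simp: cutoff_def)
  ultimately have "cutoff f \<in> Hinf" using f by (simp add: Hinf_def)
  moreover have "AE t in lborel. t \<in> {0..2*pi} \<longrightarrow>
      (\<exists>L. cmod L = 1 \<and> ((\<lambda>r. f (complex_of_real r * cis t)) \<longlongrightarrow> L) (at_left 1))"
    using assms by (simp add: inner_fun_def)
  moreover have "((\<lambda>r. cutoff f (complex_of_real r * cis t)) \<longlongrightarrow> L) (at_left 1) \<longleftrightarrow>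
      ((\<lambda>r. f (complex_of_real r * cis t)) \<longlongrightarrow> L) (at_left 1)" for t L
    by (rule tendsto_cong, rule eventually_mono[OF radial_in_disc]) (auto simp: cutoff_def)
  ultimately show "inner_fun (cutoff f)" by (simp add: inner_fun_def)
qed (simp add: cutoff_def)

text \<open>The hypothesis on divisors gives only a bounded quotient. On almost every radius m and p
  have unimodular limits, so p is nonzero near the boundary and q = m / p has a unimodular limit as
  well.\<close>

lemma inner_quotient:
  assumes m: "inner_fun m" and p: "inner_fun p" and q: "q \<in> Hinf"
    and mpq: "\<And>w. w \<in> disc \<Longrightarrow> m w = p w * q w"
  shows "inner_fun q"
proof -
  have "AE t in lborel. t \<in> {0..2*pi} \<longrightarrow>
      (\<exists>L. cmod L = 1 \<and> ((\<lambda>r. m (complex_of_real r * cis t)) \<longlongrightarrow> L) (at_left 1))"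
    using m by (simp add: inner_fun_def)
  moreover have "AE t in lborel. t \<in> {0..2*pi} \<longrightarrow>
      (\<exists>L. cmod L = 1 \<and> ((\<lambda>r. p (complex_of_real r * cis t)) \<longlongrightarrow> L) (at_left 1))"
    using p by (simp add: inner_fun_def)
  ultimately have "AE t in lborel. t \<in> {0..2*pi} \<longrightarrow>
      (\<exists>L. cmod L = 1 \<and> ((\<lambda>r. q (complex_of_real r * cis t)) \<longlongrightarrow> L) (at_left 1))"
  proof eventually_elim
    case (elim t)
    show ?case
    proof
      assume "t \<in> {0..2*pi}"
      then obtain L K where L: "cmod L = 1" "((\<lambda>r. m (complex_of_real r * cis t)) \<longlongrightarrow> L) (at_left 1)"
        and K: "cmod K = 1" "((\<lambda>r. p (complex_of_real r * cis t)) \<longlongrightarrow> K) (at_left 1)"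
        using elim by blast
      have K0: "K \<noteq> 0" using K(1) by auto
      have "((\<lambda>r. m (complex_of_real r * cis t) / p (complex_of_real r * cis t)) \<longlongrightarrow> L / K) (at_left 1)"
        by (rule tendsto_divide[OF L(2) K(2) K0])
      moreover have "eventually (\<lambda>r. m (complex_of_real r * cis t) / p (complex_of_real r * cis t)
          = q (complex_of_real r * cis t)) (at_left 1)"
        using radial_in_disc[of t] tendsto_imp_eventually_ne[OF K(2) K0]
        by eventually_elim (simp add: mpq)
      ultimately have "((\<lambda>r. q (complex_of_real r * cis t)) \<longlongrightarrow> L / K) (at_left 1)"
        by (rule Lim_transform_eventually)
      moreover have "cmod (L / K) = 1" using L(1) K(1) by (simp add: norm_divide)
      ultimately show "\<exists>L. cmod L = 1 \<and> ((\<lambda>r. q (complex_of_real r * cis t)) \<longlongrightarrow> L) (at_left 1)" by blast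
    qed
  qed
  then show ?thesis using q by (simp add: inner_fun_def)
qed

text \<open>Elements of \<open>H2\<close> vanish off the disc, so the values of m there do not
  affect the products. Hence the model space and T are unchanged.\<close>

lemma mH2_cutoff: "mH2 (cutoff m) = mH2 m"
proof -
  have "(\<lambda>z. cutoff m z * g z) = (\<lambda>z. m z * g z)" if "g \<in> H2" for g
    using H2_outside[OF that] by (auto simp: cutoff_def fun_eq_iff)
  then show ?thesis unfolding mH2_def by (intro Collect_cong ex_cong1) (auto cong: conj_cong)
qed

lemma model_space_cutoff: "model_space (cutoff m) = model_space m"
  unfolding model_space_def mH2_cutoff ..

lemma Tm_cutoff: "Tm (cutoff m) = Tm m"
  unfolding Tm_def[abs_def] model_space_cutoff ..

theorem theorem3:
  fixes m :: "complex \<Rightarrow> complex"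
  assumes inner_m: "inner_fun m"
    and dimH: "\<exists>f\<in>model_space m. \<exists>g\<in>model_space m.
                 \<forall>a b. (\<lambda>z. a * f z + b * g z) = (\<lambda>z. 0) \<longrightarrow> a = 0 \<and> b = 0"
    and A: "\<not> (\<forall>w\<in>disc. m w = m (- w))"
    and B: "\<forall>w0\<in>disc. m w0 = 0 \<longrightarrow>
              (let m0 = (\<lambda>w. m w / ((w - w0) / (1 - cnj w0 * w)))
               in \<not> (\<forall>w\<in>disc - {w0, - w0}. m0 w = m0 (- w)))"
    and C: "\<exists>p q. inner_fun p \<and> q \<in> Hinf \<and> (\<forall>w\<in>disc. m w = p w * q w)
              \<and> \<not> (\<exists>c. \<forall>w\<in>disc. p w = c)
              \<and> (\<forall>w\<in>disc. p w = p (- w))"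
  shows "irreducible_op (model_space m) (\<lambda>f. Tm m (Tm m f))
       \<and> Lat (model_space m) (\<lambda>f. Tm m (Tm m f)) \<noteq> HypLat (model_space m) (\<lambda>f. Tm m (Tm m f))"
proof -
  interpret disc_inner_fun "cutoff m" by (rule cutoff_disc_inner_fun[OF inner_m])
  \<comment> \<open>The disc is symmetric, so truncation is compatible with reflection.\<close>
  have cut: "cutoff m w = m w" "cutoff m (- w) = m (- w)" if "w \<in> disc" for w
    using that by (auto simp: cutoff_def)
  have "irreducible_op (model_space (cutoff m)) (\<lambda>f. Tm (cutoff m) (Tm (cutoff m) f))"
  proof (rule irreducible_Tm2)
    obtain w where w: "w \<in> disc" "m w \<noteq> m (- w)" using A by blast
    then have "cutoff m w \<noteq> cutoff m (- w)" by (simp only: cut not_False_eq_True)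
    then show "\<exists>w\<in>disc. cutoff m w \<noteq> cutoff m (- w)" using w(1) by blast
    fix w0 :: complex assume w0: "w0 \<in> disc" "cutoff m w0 = 0"
    then have "m w0 = 0" by (simp only: cut)
    then have "\<not> (\<forall>w\<in>disc - {w0, - w0}. m w / ((w - w0) / (1 - cnj w0 * w)) =
        m (- w) / ((- w - w0) / (1 - cnj w0 * (- w))))"
      using B[unfolded Let_def, rule_format, OF w0(1)] by blast
    then obtain w where w: "w \<in> disc - {w0, - w0}" "m w / ((w - w0) / (1 - cnj w0 * w)) \<noteq>
        m (- w) / ((- w - w0) / (1 - cnj w0 * (- w)))" by blast
    moreover have "w \<in> disc" using w(1) by blast
    ultimately show "\<exists>w\<in>disc - {w0, - w0}. cutoff m w / ((w - w0) / (1 - cnj w0 * w)) \<noteq>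
        cutoff m (- w) / ((- w - w0) / (1 - cnj w0 * (- w)))"
      by (intro bexI[OF _ w(1)]) (simp only: cut not_False_eq_True)
  qed
  moreover obtain p q where p: "inner_fun p" and q: "q \<in> Hinf" and mpq: "\<And>w. w \<in> disc \<Longrightarrow> m w = p w * q w"
    and nonconst: "\<not> (\<exists>c. \<forall>w\<in>disc. p w = c)" and even: "\<And>w. w \<in> disc \<Longrightarrow> p w = p (- w)"
    using C by blast
  have "Lat (model_space (cutoff m)) (\<lambda>f. Tm (cutoff m) (Tm (cutoff m) f))
      \<noteq> HypLat (model_space (cutoff m)) (\<lambda>f. Tm (cutoff m) (Tm (cutoff m) f))"
  proof (rule Lat_Tm2_neq_HypLat)
    show "disc_inner_fun (cutoff p)" by (rule cutoff_disc_inner_fun[OF p])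
    show "disc_inner_fun (cutoff q)" by (rule cutoff_disc_inner_fun[OF inner_quotient[OF inner_m p q mpq]])
    show "cutoff m z = cutoff p z * cutoff q z" for z using mpq[of z] by (simp add: cutoff_def)
    show "cutoff p w = cutoff p (- w)" if "cmod w < 1" for w using even[of w] that by (simp add: cutoff_def)
    show "\<not> (\<exists>c. \<forall>w\<in>disc. cutoff p w = c)" using nonconst by (auto simp: cutoff_def)
  qed
  ultimately show ?thesis unfolding model_space_cutoff Tm_cutoff ..
qed



end
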